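(* Let $(a_j)_{j \ge 0}$ be a sequence of real numbers such that the set $\{a_j : j \in \mathbb{N}\} \subset \mathbb{R}$ is finite and $a_j \neq 0$ for all sufficiently large $j$. Let $$T_n(t) = \sum_{j=0}^n a_j \cos(jt).$$ Then $\lim_{n \to \infty} \mathrm{NZ}(T_n) = \infty$.
   Context: $\mathrm{NZ}(T_n)$ denotes the number of real zeros of the trigonometric polynomial $T_n$, counted with multiplicities, in a period $[a,a+2\pi)$, $a \in \mathbb{R}$ (with value $\infty$ if $T_n\equiv 0$). *)

theory Defs
  imports "HOL-Analysis.Analysis"
begin

definition cos_poly :: "(nat \<Rightarrow> real) \<Rightarrow> nat \<Rightarrow> real \<Rightarrow> real" where
  "cos_poly a n t = (\<Sum>j\<le>n. a j * cos (real j * t))"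

text \<open>The multiplicity of \<open>t\<close> as a zero of a smooth function \<open>f\<close>: the order of the first
  derivative not vanishing at \<open>t\<close> (so \<open>0\<close> if \<open>f t \<noteq> 0\<close>). The infimum of the empty set
  in \<^typ>\<open>enat\<close> is \<open>\<infinity>\<close>, which is the value if all derivatives vanish at \<open>t\<close>.\<close>

definition zero_mult :: "(real \<Rightarrow> real) \<Rightarrow> real \<Rightarrow> enat" where
  "zero_mult f t = (INF k\<in>{k. (deriv ^^ k) f t \<noteq> 0}. enat k)"

definition period_zeros :: "real \<Rightarrow> (real \<Rightarrow> real) \<Rightarrow> real set" where
  "period_zeros c f = {t \<in> {c..<c + 2 * pi}. f t = 0}"

text \<open>A trigonometric polynomial has infinitely many zeros in a period only if it vanishes
  identically, so for these the second case is the convention \<open>NZ = \<infinity>\<close> for the zero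
  polynomial. It also guards against \<^const>\<open>sum\<close> being \<open>0\<close> over infinite sets.\<close>

definition NZ :: "real \<Rightarrow> (real \<Rightarrow> real) \<Rightarrow> enat" where
  "NZ c f = (if finite (period_zeros c f) then \<Sum>t\<in>period_zeros c f. zero_mult f t else \<infinity>)"

lemma NZ_zero: "NZ c (\<lambda>t. 0) = \<infinity>"
proof -
  have "infinite {c..<c + 2 * pi}"
    using infinite_Ico[of c "c + 2 * pi"] pi_gt_zero by auto
  then show ?thesis
    by (simp add: NZ_def period_zeros_def atLeastLessThan_def atLeast_def lessThan_def Collect_conj_eq)
qed

end

theory Submission
  imports Defs "HOL-Complex_Analysis.Great_Picard" "HOL-Real_Asymp.Real_Asymp"
begin

text \<open>Suppose \<open>T\<^sub>n\<close> has fewer than \<open>K\<close> zeros for infinitely many \<open>n\<close>. For these \<open>n\<close> there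
  is a product \<open>P\<^sub>n\<close> of \<open>K\<close> factors \<open>cos t - y\<close> with \<open>P\<^sub>n T\<^sub>n \<ge> 0\<close>. Along a subsequence
  \<open>P\<^sub>n\<close> converges to some \<open>P\<close>, and the cosine coefficients of \<open>P\<^sub>n T\<^sub>n\<close> converge to a sequence
  \<open>b\<close> (formally those of \<open>P\<close> times the infinite cosine series), which is positive definite and
  takes finitely many values.

  Since \<open>P\<^sub>n T\<^sub>n\<close> has no frequencies above \<open>n + K\<close> but agrees with \<open>b\<close> below \<open>n - K\<close>, an
  argument in the spirit of the F. and M. Riesz theorem shows that \<open>b\<close> vanishes on long windows
  around infinitely many \<open>n\<close>. If \<open>b\<close> were not eventually zero, there would be arbitrarily long gaps
  of zeros ending in a nonzero value \<open>b s\<close>, and a sparse sequence of such \<open>s\<close> contradicts Bessel's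
  inequality. So \<open>b\<close> is eventually zero, which is a linear recurrence for \<open>(a\<^sub>j)\<close>; having finitely
  many values, \<open>(a\<^sub>j)\<close> is eventually periodic.

  In the periodic case, \<open>T\<^sub>n(\<theta> + u/n) / n\<close> converges for every \<open>q\<close>-th root of unity
  \<open>e\<^sup>i\<^sup>\<theta>\<close> to a nonnegative multiple of \<open>(sin (u + \<psi>) - sin \<psi>) / u\<close>, with \<open>\<psi>\<close> the argument
  of a Fourier coefficient of the period. As \<open>a\<^sub>j \<noteq> 0\<close> for some \<open>j\<close> divisible by \<open>q\<close>, some
  such coefficient is not purely imaginary, and then the limit changes sign infinitely often.\<close>

section \<open>Multiplying cosine sums by linear factors\<close>

text \<open>Summing over all integers from \<open>- R\<close> to \<open>R\<close> makes
  multiplication by \<open>cos t\<close> a plain averaging of neighbouring coefficients, with no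
  special case at frequency 0.\<close>

definition cos_sum :: "nat \<Rightarrow> (int \<Rightarrow> real) \<Rightarrow> real \<Rightarrow> real" where
  "cos_sum R c t = (\<Sum>j\<in>{- int R..int R}. c j * cos (of_int j * t))"

text \<open>By the product-to-sum formula, these are the coefficients of \<open>cos t - y\<close>
  times the cosine sum of \<open>c\<close>.\<close>

definition cos_factor :: "real \<Rightarrow> (int \<Rightarrow> real) \<Rightarrow> int \<Rightarrow> real" where
  "cos_factor y c j = (c (j - 1) + c (j + 1)) / 2 - y * c j"

primrec cos_factors :: "(nat \<Rightarrow> real) \<Rightarrow> nat \<Rightarrow> (int \<Rightarrow> real) \<Rightarrow> int \<Rightarrow> real" where
  "cos_factors y 0 c = c"
| "cos_factors y (Suc k) c = cos_factor (y k) (cos_factors y k c)"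

text \<open>Each factor reads only the neighbours of an index, so \<open>k\<close> factors reach no
  further than distance \<open>k\<close>. Hence truncating a series has no effect on the product
  well below the cut-off.\<close>

lemma cos_factors_local:
  assumes "\<And>i. \<bar>i - j\<bar> \<le> int k \<Longrightarrow> c i = d i"
  shows "cos_factors y k c j = cos_factors y k d j"
  using assms
proof (induction k arbitrary: j)
  case (Suc k)
  have "cos_factors y k c i = cos_factors y k d i" if "\<bar>i - j\<bar> \<le> 1" for i
    using that by (intro Suc.IH Suc.prems) linarith
  then show ?case by (simp add: cos_factor_def)
qed simp

lemma cos_factors_zero: "cos_factors y k (\<lambda>_. 0) j = 0"
  by (induction k arbitrary: j) (simp_all add: cos_factor_def)

lemma cos_factors_support:
  assumes "\<And>j. \<bar>j\<bar> > R \<Longrightarrow> c j = 0" and "\<bar>j\<bar> > R + int k"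
  shows "cos_factors y k c j = 0"
proof -
  have "cos_factors y k c j = cos_factors y k (\<lambda>_. 0) j"
    using assms by (intro cos_factors_local) auto
  then show ?thesis by (simp add: cos_factors_zero)
qed

lemma cos_factors_even:
  assumes "\<And>j. c (- j) = c j"
  shows "cos_factors y k c (- j) = cos_factors y k c j"
proof (induction k arbitrary: j)
  case (Suc k)
  have "cos_factors y k c (- j - 1) = cos_factors y k c (j + 1)" "cos_factors y k c (- j + 1) = cos_factors y k c (j - 1)"
    using Suc.IH[of "j + 1"] Suc.IH[of "j - 1"] by (simp_all only: minus_add_distrib minus_diff_eq
      diff_conv_add_uminus minus_minus add.commute)
  with Suc.IH[of j] show ?case by (simp add: cos_factor_def)
qed (use assms in simp)

text \<open>Only the path stepping to the right neighbour in every factor reaches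
  \<open>j + int k\<close>, and it collects the weight 1/2 each time, whatever the roots are. So an
  equation \<open>cos_factors y k c j = 0\<close> can be solved for the topmost entry of its
  window.\<close>

lemma cos_factors_lead:
  assumes "\<And>i. \<bar>i - j\<bar> \<le> int k \<Longrightarrow> i \<noteq> j + int k \<Longrightarrow> c i = d i"
  shows "cos_factors y k c j - cos_factors y k d j = (c (j + int k) - d (j + int k)) / 2 ^ k"
  using assms
proof (induction k arbitrary: j)
  case (Suc k)
  have "cos_factors y k c i = cos_factors y k d i" if "i \<in> {j, j - 1}" for i
    using that by (intro cos_factors_local Suc.prems) auto
  moreover have "cos_factors y k c (j + 1) - cos_factors y k d (j + 1)
      = (c (j + 1 + int k) - d (j + 1 + int k)) / 2 ^ k"
    by (intro Suc.IH Suc.prems) auto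
  ultimately show ?case by (simp add: cos_factor_def field_simps)
qed simp

lemma cos_factors_finite_range:
  assumes "finite (range c)"
  shows "finite (range (cos_factors y k c))"
proof (induction k)
  case (Suc k)
  let ?S = "range (cos_factors y k c)"
  have "range (cos_factors y (Suc k) c) \<subseteq> (\<lambda>(u, v, w). (u + v) / 2 - y k * w) ` (?S \<times> ?S \<times> ?S)"
    by (force simp: cos_factor_def)
  then show ?case
    using Suc by (meson finite_SigmaI finite_imageI finite_subset)
qed (use assms in simp)

lemma abs_cos_factor_le:
  fixes u v w d X Y :: real
  assumes "\<bar>u\<bar> \<le> X" "\<bar>v\<bar> \<le> X" "\<bar>w\<bar> \<le> 2 * X" "\<bar>d\<bar> \<le> Y"
  shows "\<bar>(u + v) / 2 - w - d\<bar> \<le> 3 * X + Y"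
  using assms by (auto simp: abs_le_iff field_simps)

text \<open>A factor with root in [-2, 2] enlarges the supremum norm at most by 1 + 2 = 3.\<close>

lemma cos_factors_bound:
  assumes "\<And>i. i < k \<Longrightarrow> \<bar>y i\<bar> \<le> 2" and "\<And>i. \<bar>c i\<bar> \<le> B"
  shows "\<bar>cos_factors y k c j\<bar> \<le> 3 ^ k * B"
  using assms(1)
proof (induction k arbitrary: j)
  case (Suc k)
  let ?u = "cos_factors y k c"
  have u: "\<bar>?u i\<bar> \<le> 3 ^ k * B" for i
    using Suc by simp
  have "\<bar>y k * ?u j\<bar> \<le> 2 * (3 ^ k * B)"
    unfolding abs_mult using Suc.prems[of k] u[of j] by (intro mult_mono) auto
  with abs_cos_factor_le[OF u u this, of 0 0 "j - 1" "j + 1"] have "\<bar>cos_factor (y k) ?u j\<bar> \<le> 3 * (3 ^ k * B)"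
    by (simp add: cos_factor_def)
  then show ?case by (simp add: mult.assoc)
qed (use assms(2) in simp)

text \<open>Continuity in the roots, uniformly in the index \<open>j\<close>. It serves to compare
  the coefficients for given roots with those for the limiting roots at all frequencies at
  once.\<close>

lemma cos_factors_lipschitz:
  assumes "\<And>i. i < k \<Longrightarrow> \<bar>y i\<bar> \<le> 2" and "\<And>i. i < k \<Longrightarrow> \<bar>y' i\<bar> \<le> 2"
    and "\<And>i. i < k \<Longrightarrow> \<bar>y i - y' i\<bar> \<le> e" and "\<And>i. \<bar>c i\<bar> \<le> B"
  shows "\<bar>cos_factors y k c j - cos_factors y' k c j\<bar> \<le> real k * 3 ^ k * B * e"
  using assms(1-3)
proof (induction k arbitrary: j)
  case (Suc k)
  let ?u = "cos_factors y k c" and ?v = "cos_factors y' k c"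
  let ?L = "real k * 3 ^ k * B * e"
  have uv: "\<bar>?u i - ?v i\<bar> \<le> ?L" for i
    using Suc by simp
  have v: "\<bar>?v j\<bar> \<le> 3 ^ k * B"
    using Suc.prems(2) assms(4) by (intro cos_factors_bound) auto
  have e: "0 \<le> e" and B: "0 \<le> B"
    using Suc.prems(3)[of k] assms(4)[of 0] by auto
  have 1: "\<bar>y k * (?u j - ?v j)\<bar> \<le> 2 * ?L"
    unfolding abs_mult using Suc.prems(1)[of k] uv[of j] by (intro mult_mono) auto
  have 2: "\<bar>(y k - y' k) * ?v j\<bar> \<le> e * (3 ^ k * B)"
    unfolding abs_mult using Suc.prems(3)[of k] v e by (intro mult_mono) auto
  have "cos_factors y (Suc k) c j - cos_factors y' (Suc k) c j
     = ((?u (j - 1) - ?v (j - 1)) + (?u (j + 1) - ?v (j + 1))) / 2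
       - y k * (?u j - ?v j) - (y k - y' k) * ?v j"
    by (simp add: cos_factor_def field_simps)
  then have "\<bar>cos_factors y (Suc k) c j - cos_factors y' (Suc k) c j\<bar> \<le> 3 * ?L + e * (3 ^ k * B)"
    using abs_cos_factor_le[OF uv uv 1 2] by simp
  also have "\<dots> \<le> 3 * ?L + 3 * (e * (3 ^ k * B))"
    using e B by simp
  also have "\<dots> = real (Suc k) * 3 ^ Suc k * B * e"
    by (simp add: algebra_simps)
  finally show ?case .
qed simp

section \<open>Effect of the factors on the cosine sum as a function\<close>

lemma cos_sum_extend:
  assumes "\<And>j. \<bar>j\<bar> > int R \<Longrightarrow> c j = 0" and "R \<le> R'"
  shows "cos_sum R' c t = cos_sum R c t"
  unfolding cos_sum_def using assms by (intro sum.mono_neutral_right) auto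

lemma cos_sum_factor:
  assumes c: "\<And>j. \<bar>j\<bar> > int R \<Longrightarrow> c j = 0"
  shows "cos_sum (Suc R) (cos_factor y c) t = (cos t - y) * cos_sum R c t"
proof -
  let ?I = "{- int R..int R}" and ?J = "{- int (Suc R)..int (Suc R)}"
  have l: "(\<Sum>j\<in>?J. c (j - 1) * cos (of_int j * t)) = (\<Sum>j\<in>?I. c j * cos (of_int (j + 1) * t))"
  proof -
    have "(\<Sum>j\<in>?J. c (j - 1) * cos (of_int j * t))
        = (\<Sum>j\<in>(\<lambda>j. j + 1) ` ?I. c (j - 1) * cos (of_int j * t))"
      using c by (intro sum.mono_neutral_right)
        (auto simp: image_iff intro!: c bexI[where x = "_ - 1"])
    also have "\<dots> = (\<Sum>j\<in>?I. c j * cos (of_int (j + 1) * t))"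
      by (subst sum.reindex) (auto simp: inj_on_def)
    finally show ?thesis .
  qed
  have r: "(\<Sum>j\<in>?J. c (j + 1) * cos (of_int j * t)) = (\<Sum>j\<in>?I. c j * cos (of_int (j - 1) * t))"
  proof -
    have "(\<Sum>j\<in>?J. c (j + 1) * cos (of_int j * t))
        = (\<Sum>j\<in>(\<lambda>j. j - 1) ` ?I. c (j + 1) * cos (of_int j * t))"
      using c by (intro sum.mono_neutral_right)
        (auto simp: image_iff intro!: c bexI[where x = "_ + 1"])
    also have "\<dots> = (\<Sum>j\<in>?I. c j * cos (of_int (j - 1) * t))"
      by (subst sum.reindex) (auto simp: inj_on_def)
    finally show ?thesis .
  qed
  have "cos_sum (Suc R) (cos_factor y c) t = (\<Sum>j\<in>?J. c (j - 1) * cos (of_int j * t)) / 2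
      + (\<Sum>j\<in>?J. c (j + 1) * cos (of_int j * t)) / 2 - y * cos_sum (Suc R) c t"
    unfolding cos_sum_def cos_factor_def
    by (simp only: sum_divide_distrib sum_distrib_left sum.distrib[symmetric] sum_subtractf[symmetric])
      (intro sum.cong refl, simp add: field_simps)
  also have "\<dots> = (\<Sum>j\<in>?I. c j * (cos (of_int (j + 1) * t) + cos (of_int (j - 1) * t)) / 2)
      - y * cos_sum R c t"
    unfolding l r using cos_sum_extend[OF c, where R' = "Suc R"]
    by (simp add: sum_divide_distrib sum.distrib[symmetric] algebra_simps add_divide_distrib)
  also have "(\<lambda>j. c j * (cos (of_int (j + 1) * t) + cos (of_int (j - 1) * t)) / 2)
      = (\<lambda>j. cos t * (c j * cos (of_int j * t)))"
    by (simp add: fun_eq_iff algebra_simps cos_add cos_diff)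
  finally show ?thesis
    by (simp only: cos_sum_def sum_distrib_left[symmetric] left_diff_distrib)
qed

lemma cos_sum_factors:
  assumes "\<And>j. \<bar>j\<bar> > int R \<Longrightarrow> c j = 0"
  shows "cos_sum (R + k) (cos_factors y k c) t = (\<Prod>i<k. cos t - y i) * cos_sum R c t"
proof (induction k)
  case (Suc k)
  have "cos_sum (Suc (R + k)) (cos_factor (y k) (cos_factors y k c)) t
      = (cos t - y k) * cos_sum (R + k) (cos_factors y k c) t"
    using cos_factors_support[of "int R" c, OF assms] by (intro cos_sum_factor) auto
  with Suc show ?case by (simp add: mult_ac)
qed simp

section \<open>Zeros and sign factors\<close>

text \<open>These are the Chebyshev polynomials, built from their three-term recurrence. They turn
  zeros of a cosine polynomial into roots in [-1, 1].\<close>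

lemma cos_multiple_eq_poly: "\<exists>C :: real poly. \<forall>t. poly C (cos t) = cos (real j * t)"
proof (induction j rule: less_induct)
  case (less j)
  show ?case
  proof (cases "j \<le> 1")
    case True
    then consider "j = 0" | "j = 1" by linarith
    then show ?thesis
    proof cases
      case 1
      then show ?thesis by (intro exI[of _ 1]) simp
    next
      case 2
      then show ?thesis by (intro exI[of _ "[:0, 1:]"]) simp
    qed
  next
    case False
    then obtain i where i: "j = i + 2" using le_Suc_ex[of 2 j] by (auto simp: add.commute)
    obtain C D where "\<forall>t. poly C (cos t) = cos (real i * t)" "\<forall>t. poly D (cos t) = cos (real (i + 1) * t)"
      using less[of i] less[of "i + 1"] i by auto
    moreover have "cos (real (i + 2) * t) = 2 * cos t * cos (real (i + 1) * t) - cos (real i * t)" for t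
    proof -
      have "cos (real (i + 1) * t + t) + cos (real (i + 1) * t - t) = 2 * cos t * cos (real (i + 1) * t)"
        by (simp add: cos_add cos_diff)
      then show ?thesis by (simp add: algebra_simps)
    qed
    ultimately have "\<forall>t. poly ([:0, 2:] * D - C) (cos t) = cos (real j * t)"
      by (simp add: i)
    then show ?thesis ..
  qed
qed

lemma cos_poly_eq_poly: "\<exists>Q :: real poly. \<forall>t. cos_poly a n t = poly Q (cos t)"
proof -
  obtain C :: "nat \<Rightarrow> real poly" where "\<And>j t. poly (C j) (cos t) = cos (real j * t)"
    using cos_multiple_eq_poly by metis
  then have "\<forall>t. cos_poly a n t = poly (\<Sum>j\<le>n. smult (a j) (C j)) (cos t)"
    by (simp add: cos_poly_def poly_sum)
  then show ?thesis ..
qed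

text \<open>\<open>D\<close> collects the roots in [-1, 1] of odd multiplicity, where the sign
  changes, and \<open>s\<close> is a global sign. The induction splits off one root at a time, and
  each root toggles its own membership in \<open>D\<close>.\<close>

lemma poly_sign_set:
  fixes Q :: "real poly"
  assumes "Q \<noteq> 0"
  shows "\<exists>D s. finite D \<and> D \<subseteq> {x \<in> {-1..1}. poly Q x = 0} \<and> s \<in> {1, - 1} \<and>
    (\<forall>x\<in>{-1..1}. 0 \<le> s * (poly Q x * (\<Prod>d\<in>D. x - d)))"
  using assms
proof (induction "degree Q" arbitrary: Q rule: less_induct)
  case less
  show ?case
  proof (cases "\<exists>z\<in>{-1..1}. poly Q z = 0")
    case True
    then obtain z where z: "z \<in> {-1..1}" "poly Q z = 0" by blast
    then obtain R where Q: "Q = [:- z, 1:] * R"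
      by (metis dvdE poly_eq_0_iff_dvd)
    with less.prems have "R \<noteq> 0" by auto
    moreover from this have "degree R < degree Q"
      unfolding Q by (subst degree_mult_eq) auto
    ultimately obtain D s where D: "finite D" "D \<subseteq> {x \<in> {-1..1}. poly R x = 0}" "s \<in> {1, - 1}"
      and pos: "\<And>x. x \<in> {-1..1} \<Longrightarrow> 0 \<le> s * (poly R x * (\<Prod>d\<in>D. x - d))"
      using less.hyps[of R] by blast
    show ?thesis
    proof (cases "z \<in> D")
      case True
      have "poly Q x * (\<Prod>d\<in>D - {z}. x - d) = poly R x * (\<Prod>d\<in>D. x - d)" for x
        unfolding prod.remove[OF D(1) True] Q by (simp add: algebra_simps)
      then have "\<forall>x\<in>{-1..1}. 0 \<le> s * (poly Q x * (\<Prod>d\<in>D - {z}. x - d))"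
        using pos by simp
      moreover have "D - {z} \<subseteq> {x \<in> {-1..1}. poly Q x = 0}"
        using D(2) unfolding Q by auto
      ultimately show ?thesis using D by blast
    next
      case False
      have eq: "s * (poly Q x * (\<Prod>d\<in>insert z D. x - d))
          = (x - z)\<^sup>2 * (s * (poly R x * (\<Prod>d\<in>D. x - d)))" for x
        using False D(1) by (simp add: Q power2_eq_square algebra_simps)
      have "0 \<le> s * (poly Q x * (\<Prod>d\<in>insert z D. x - d))" if "x \<in> {-1..1}" for x
        unfolding eq using pos[OF that] by simp
      moreover have "insert z D \<subseteq> {x \<in> {-1..1}. poly Q x = 0}"
        using D(2) z unfolding Q by auto
      ultimately show ?thesis
        using D by (intro exI[of _ "insert z D"] exI[of _ s] conjI ballI) simp_all
    qed
  next
    case False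
    have same: "0 < poly Q x * poly Q 0" if x: "x \<in> {-1..1}" for x
    proof (rule ccontr)
      assume "\<not> ?thesis"
      moreover have "poly Q x \<noteq> 0" "poly Q 0 \<noteq> 0" using False x by auto
      ultimately have neg: "poly Q x * poly Q 0 < 0"
        by (simp add: not_less less_le)
      then have "x \<noteq> 0" by auto
      then have "\<exists>w. min x 0 < w \<and> w < max x 0 \<and> poly Q w = 0"
        using neg poly_IVT[of x 0 Q] poly_IVT[of 0 x Q] by (auto simp: mult.commute min_def max_def)
      then show False using False x by (auto simp: min_def max_def split: if_splits)
    qed
    show ?thesis
      using same by (intro exI[of _ "{}"] exI[of _ "sgn (poly Q 0)"])
        (auto simp: sgn_if zero_less_mult_iff less_imp_le, (use False in force)?)
  qed
qed

text \<open>Having exactly \<open>K\<close> factors with roots in [-2, 2] places the roots belonging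
  to different polynomials in one compact set.\<close>

lemma exists_sign_factors:
  fixes Q :: "real poly"
  assumes "Q \<noteq> 0" and "card {x \<in> {-1..1}. poly Q x = 0} < K"
  shows "\<exists>y. (\<forall>i. \<bar>y i\<bar> \<le> 2) \<and> (\<forall>x\<in>{-1..1}. 0 \<le> (\<Prod>i<K. x - y i) * poly Q x)"
proof -
  have enumerate: "\<exists>y. (\<forall>i. \<bar>y i\<bar> \<le> 2) \<and>
      (\<forall>x\<in>{-1..1}. \<exists>e>0. (\<Prod>i<K. x - y i) = e * (\<Prod>d\<in>D. x - d))"
    if D: "finite D" "D \<subseteq> {-2..2}" "card D \<le> K" for D :: "real set"
  proof -
    obtain f where f: "bij_betw f {..<card D} D"
      using D(1) by (metis atLeast0LessThan ex_bij_betw_nat_finite)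
    \<comment> \<open>Surplus positions get the root -2, whose factor \<open>x + 2\<close> is
      positive on [-1, 1].\<close>
    define y where "y i = (if i < card D then f i else - 2)" for i
    have "\<bar>y i\<bar> \<le> 2" for i
    proof (cases "i < card D")
      case True
      then have "f i \<in> D" using f by (auto simp: bij_betw_def)
      with D(2) have "f i \<in> {-2..2}" by blast
      with True show ?thesis by (auto simp: y_def)
    qed (simp add: y_def)
    moreover have "(\<Prod>i<K. x - y i) = (\<Prod>i=card D..<K. x + 2) * (\<Prod>d\<in>D. x - d)" for x
    proof -
      have "(\<Prod>i<K. x - y i) = (\<Prod>i<card D. x - y i) * (\<Prod>i=card D..<K. x - y i)"
        using D(3) by (subst prod.union_disjoint[symmetric]) (auto simp: ivl_disj_un)
      also have "(\<Prod>i<card D. x - y i) = (\<Prod>i<card D. x - f i)"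
        by (simp add: y_def)
      also have "\<dots> = (\<Prod>d\<in>D. x - d)"
        using prod.reindex_bij_betw[OF f] by auto
      also have "(\<Prod>i=card D..<K. x - y i) = (\<Prod>i=card D..<K. x + 2)"
        by (simp add: y_def)
      finally show ?thesis by (simp add: mult.commute)
    qed
    moreover have "0 < (\<Prod>i=card D..<K. x + 2)" if "x \<in> {-1..1}" for x :: real
      using that by (intro prod_pos) auto
    ultimately show ?thesis by blast
  qed
  obtain D s where D: "finite D" "D \<subseteq> {x \<in> {-1..1}. poly Q x = 0}" "s \<in> {1, - 1}"
    and pos: "\<And>x. x \<in> {-1..1} \<Longrightarrow> 0 \<le> s * (poly Q x * (\<Prod>d\<in>D. x - d))"
    using poly_sign_set[OF assms(1)] by blast
  \<comment> \<open>The root \<open>2\<close> only contributes the sign \<open>- 1\<close> on \<open>[- 1, 1]\<close>.\<close>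
  define D' where "D' = (if s = 1 then D else insert 2 D)"
  have "card D \<le> card {x \<in> {-1..1}. poly Q x = 0}"
    using D(2) poly_roots_finite[OF assms(1)] by (intro card_mono) (auto elim: finite_subset[rotated])
  \<comment> \<open>The number of roots is strictly below \<open>K\<close>, which leaves room for
    the additional root 2.\<close>
  with assms(2) have "card D' \<le> K"
    using D(1) card_insert_le_m1[of K D] by (auto simp: D'_def card_insert_if)
  then obtain y where y: "\<And>i. \<bar>y i\<bar> \<le> 2"
    and eq: "\<And>x. x \<in> {-1..1} \<Longrightarrow> \<exists>e>0. (\<Prod>i<K. x - y i) = e * (\<Prod>d\<in>D'. x - d)"
    using enumerate[of D'] D by (auto simp: D'_def split: if_splits) (force)+
  have "0 \<le> (\<Prod>i<K. x - y i) * poly Q x" if x: "x \<in> {-1..1}" for x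
  proof -
    obtain e where e: "e > 0" "(\<Prod>i<K. x - y i) = e * (\<Prod>d\<in>D'. x - d)"
      using eq[OF x] by blast
    have "2 \<notin> D" using D(2) by auto
    then have "\<exists>r\<ge>0. (\<Prod>d\<in>D'. x - d) = r * (s * (\<Prod>d\<in>D. x - d))"
    proof (cases "s = 1")
      case False
      with D \<open>2 \<notin> D\<close> have "(\<Prod>d\<in>D'. x - d) = (2 - x) * (s * (\<Prod>d\<in>D. x - d))"
        by (auto simp: D'_def algebra_simps)
      with x show ?thesis by (intro exI[of _ "2 - x"]) auto
    qed (auto simp: D'_def intro: exI[of _ 1])
    then obtain r where r: "r \<ge> 0" "(\<Prod>d\<in>D'. x - d) = r * (s * (\<Prod>d\<in>D. x - d))" by blast
    have "(\<Prod>i<K. x - y i) * poly Q x = (e * r) * (s * (poly Q x * (\<Prod>d\<in>D. x - d)))"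
      using e r by simp
    moreover have "0 \<le> (e * r) * (s * (poly Q x * (\<Prod>d\<in>D. x - d)))"
      by (rule mult_nonneg_nonneg[OF mult_nonneg_nonneg pos[OF x]]) (use e(1) r(1) in auto)
    ultimately show ?thesis by (simp only:)
  qed
  with y show ?thesis by blast
qed

section \<open>Counting distinct zeros in a period\<close>

lemma cos_poly_periodic: "cos_poly a n (t + 2 * pi * of_int k) = cos_poly a n t"
proof -
  have "cos (real j * (t + 2 * pi * of_int k)) = cos (real j * t)" for j
  proof -
    have "real j * (t + 2 * pi * of_int k) = real j * t + of_int (int j * k) * (2 * pi)"
      by (simp add: algebra_simps)
    then show ?thesis
      using cos_int_2pin[of "int j * k"] sin_int_2pin[of "int j * k"]
      by (simp add: cos_add mult.commute mult.left_commute)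
  qed
  then show ?thesis by (simp add: cos_poly_def)
qed

lemma zero_mult_ge_1:
  assumes "f t = 0"
  shows "1 \<le> zero_mult f t"
  unfolding zero_mult_def
proof (rule INF_greatest)
  fix k assume "k \<in> {k. (deriv ^^ k) f t \<noteq> 0}"
  with assms have "k \<noteq> 0" by (intro notI) simp
  then show "1 \<le> enat k" by (simp add: one_enat_def)
qed

text \<open>Translation by multiples of the period moves the zeros injectively into the period
  starting at \<open>c\<close>, and each of them has multiplicity at least 1.\<close>

lemma card_zeros_le_NZ:
  assumes per: "\<And>t k. f (t + 2 * pi * of_int k) = f t"
    and Z: "Z \<subseteq> {u..<u + 2 * pi}" "\<And>t. t \<in> Z \<Longrightarrow> f t = 0"
  shows "enat (card Z) \<le> NZ c f"
proof (cases "finite (period_zeros c f)")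
  case True
  define r where "r t = t + 2 * pi * of_int (- \<lfloor>(t - c) / (2 * pi)\<rfloor>)" for t
  have r: "c \<le> r t \<and> r t < c + 2 * pi" for t
  proof -
    have "of_int \<lfloor>(t - c) / (2 * pi)\<rfloor> \<le> (t - c) / (2 * pi)"
      "(t - c) / (2 * pi) < of_int \<lfloor>(t - c) / (2 * pi)\<rfloor> + 1" by linarith+
    then have "of_int \<lfloor>(t - c) / (2 * pi)\<rfloor> * (2 * pi) \<le> t - c"
      "t - c < (of_int \<lfloor>(t - c) / (2 * pi)\<rfloor> + 1) * (2 * pi)"
      using pos_le_divide_eq[of "2 * pi"] pos_divide_less_eq[of "2 * pi"] pi_gt_zero
      by (metis mult_pos_pos zero_less_numeral)+
    then show ?thesis by (simp add: r_def algebra_simps)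
  qed
  have "inj_on r Z"
  proof (rule inj_onI)
    fix s t assume st: "s \<in> Z" "t \<in> Z" "r s = r t"
    define k where "k = \<lfloor>(s - c) / (2 * pi)\<rfloor> - \<lfloor>(t - c) / (2 * pi)\<rfloor>"
    have eq: "s - t = 2 * pi * of_int k"
      using st(3) by (simp add: r_def k_def algebra_simps)
    have "s \<in> {u..<u + 2 * pi}" "t \<in> {u..<u + 2 * pi}" using st Z(1) by auto
    then have "\<bar>s - t\<bar> < 2 * pi" by (simp add: abs_less_iff)
    then have "\<bar>of_int k :: real\<bar> < 1" unfolding eq by (simp add: abs_mult)
    then have "k = 0" by linarith
    with eq show "s = t" by simp
  qed
  moreover have "r ` Z \<subseteq> period_zeros c f"
    using r Z(2) by (auto simp: period_zeros_def r_def simp del: of_int_minus intro!: trans[OF per])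
  ultimately have "card Z \<le> card (period_zeros c f)"
    using True by (metis card_image card_mono)
  then have "enat (card Z) \<le> (\<Sum>t\<in>period_zeros c f. 1)"
    by (simp add: of_nat_eq_enat)
  also have "\<dots> \<le> (\<Sum>t\<in>period_zeros c f. zero_mult f t)"
    by (intro sum_mono zero_mult_ge_1) (simp add: period_zeros_def)
  finally show ?thesis using True by (simp add: NZ_def)
qed (simp add: NZ_def)

lemma exists_cos_sign_factors:
  assumes "NZ c (cos_poly a n) < enat K"
  shows "\<exists>y. (\<forall>i. \<bar>y i\<bar> \<le> 2) \<and> (\<forall>t. 0 \<le> (\<Prod>i<K. cos t - y i) * cos_poly a n t)"
proof -
  obtain Q where Q: "\<And>t. cos_poly a n t = poly Q (cos t)"
    using cos_poly_eq_poly by blast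
  have "Q \<noteq> 0"
  proof
    assume "Q = 0"
    then have "cos_poly a n = (\<lambda>t. 0)" using Q by auto
    then show False using assms NZ_zero[of c] by simp
  qed
  let ?Z = "{x \<in> {-1..1}. poly Q x = 0}"
  \<comment> \<open>Roots of \<open>Q\<close> in [-1, 1] lift to distinct zeros in [0, pi], so
    \<open>NZ\<close> bounds their number.\<close>
  have "enat (card (arccos ` ?Z)) \<le> NZ c (cos_poly a n)"
  proof (rule card_zeros_le_NZ)
    show "cos_poly a n (t + 2 * pi * of_int k) = cos_poly a n t" for t k
      by (rule cos_poly_periodic)
    show "arccos ` ?Z \<subseteq> {0..<0 + 2 * pi}"
    proof
      fix t assume "t \<in> arccos ` ?Z"
      then have "0 \<le> t" "t \<le> pi" by (auto intro: arccos_lbound arccos_ubound)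
      then show "t \<in> {0..<0 + 2 * pi}" using pi_gt_zero by (simp del: pi_gt_zero)
    qed
    show "cos_poly a n t = 0" if "t \<in> arccos ` ?Z" for t
      using that by (auto simp: Q cos_arccos)
  qed
  moreover have "inj_on arccos ?Z"
    by (rule inj_on_inverseI[of _ cos]) (auto simp: cos_arccos)
  ultimately have "enat (card ?Z) \<le> NZ c (cos_poly a n)"
    by (simp only: card_image)
  then have "card ?Z < K"
    using le_less_trans[OF _ assms] enat_ord_simps(2) by blast
  then obtain y where "\<And>i. \<bar>y i\<bar> \<le> 2" "\<And>x. x \<in> {-1..1} \<Longrightarrow> 0 \<le> (\<Prod>i<K. x - y i) * poly Q x"
    using exists_sign_factors[OF \<open>Q \<noteq> 0\<close>] by blast
  then show ?thesis by (intro exI[of _ y]) (auto simp: Q)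
qed

section \<open>Trigonometric moments of positive measures\<close>

text \<open>For every \<open>R\<close> there is a positive measure with finite support on the unit circle whose moments
  up to order \<open>R\<close> are given by \<open>c\<close>; discrete measures keep all integrals finite sums.\<close>

definition moment_seq :: "(int \<Rightarrow> real) \<Rightarrow> bool" where
  "moment_seq c \<longleftrightarrow> (\<forall>R. \<exists>(M :: nat) w z. (\<forall>x<M. 0 \<le> w x \<and> cmod (z x) = 1) \<and>
    (\<forall>j. \<bar>j\<bar> \<le> R \<longrightarrow> (\<Sum>x<M. of_real (w x) * z x powi j) = of_real (c j)))"

lemma moment_seqE:
  assumes "moment_seq c"
  obtains M :: nat and w z where "\<And>x. x < M \<Longrightarrow> 0 \<le> w x" "\<And>x. x < M \<Longrightarrow> cmod (z x) = 1"
    "\<And>j. \<bar>j\<bar> \<le> R \<Longrightarrow> (\<Sum>x<M. of_real (w x) * z x powi j) = of_real (c j)"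
proof -
  from assms have "\<exists>(M :: nat) w z. (\<forall>x<M. 0 \<le> w x \<and> cmod (z x) = 1) \<and>
    (\<forall>j. \<bar>j\<bar> \<le> R \<longrightarrow> (\<Sum>x<M. of_real (w x) * z x powi j) = of_real (c j))"
    unfolding moment_seq_def by (rule spec)
  then obtain M w z where "\<forall>x<(M :: nat). 0 \<le> w x \<and> cmod (z x) = 1"
    "\<forall>j. \<bar>j\<bar> \<le> R \<longrightarrow> (\<Sum>x<M. of_real (w x) * z x powi j) = of_real (c j)"
    by (elim exE conjE)
  then show thesis
    by (intro that[of M w z]) simp_all
qed

text \<open>Orthogonality of characters: for \<open>d \<noteq> 0\<close> the bound on
  \<open>d\<close> keeps the ratio of the geometric sum away from 1.\<close>

lemma sum_roots_of_unity:
  assumes "\<bar>d\<bar> < int M"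
  shows "(\<Sum>x<M. cis (of_int d * (2 * pi * real x / real M))) = (if d = 0 then of_nat M else 0)"
proof (cases "d = 0")
  case False
  define \<omega> where "\<omega> = cis (2 * pi * of_int d / real M)"
  have M: "M > 0" using assms by linarith
  have "\<omega> \<noteq> 1"
  proof
    assume "\<omega> = 1"
    then have "cos (2 * pi * of_int d / real M) = 1"
      by (simp add: \<omega>_def complex_eq_iff)
    then obtain m :: int where "2 * pi * of_int d / real M = of_int m * 2 * pi"
      using cos_one_2pi_int by blast
    then have "real_of_int d = of_int (m * int M)" using M by (simp add: field_simps)
    then have "d = m * int M" by (simp only: of_int_eq_iff)
    with assms False show False by (auto simp: abs_mult mult_less_cancel_right1)
  qed
  moreover have "\<omega> ^ M = 1"
  proof -
    have "\<omega> ^ M = cis (2 * pi * of_int d)"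
      using M by (simp add: \<omega>_def Complex.DeMoivre)
    then show ?thesis using cis_multiple_2pi[of "of_int d"] by simp
  qed
  ultimately have "(\<Sum>x<M. \<omega> ^ x) = 0" by (simp add: geometric_sum)
  moreover have "cis (of_int d * (2 * pi * real x / real M)) = \<omega> ^ x" for x
    by (simp add: \<omega>_def Complex.DeMoivre mult_ac)
  ultimately show ?thesis using False by simp
qed simp

text \<open>Equal-weight quadrature at the \<open>M\<close>-th roots of unity is exact for
  trigonometric polynomials of degree below \<open>M\<close>. The measure has the sampled values of
  the nonnegative cosine sum, divided by \<open>M\<close>, as weights.\<close>

lemma moment_seq_if_nonneg:
  assumes even: "\<And>j. c (- j) = c j" and supp: "\<And>j. \<bar>j\<bar> > int R0 \<Longrightarrow> c j = 0"
    and nonneg: "\<And>t. 0 \<le> cos_sum R0 c t"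
  shows "moment_seq c"
  unfolding moment_seq_def
proof
  fix R :: int
  \<comment> \<open>This exceeds the degree \<open>R0\<close> of the sum plus the largest exponent
    \<open>R\<close> to be tested.\<close>
  define M where "M = R0 + nat R + 1"
  define t where "t x = 2 * pi * real x / real M" for x
  have key: "(\<Sum>x<M. of_real (cos_sum R0 c (t x) / M) * cis (t x) powi j) = of_real (c j)"
    if j: "\<bar>j\<bar> \<le> R" for j
  proof -
    have in_range: "\<bar>j + l\<bar> < int M" "\<bar>j - l\<bar> < int M" if "l \<in> {- int R0..int R0}" for l
      using that j by (auto simp: M_def)
    have "(\<Sum>x<M. of_real (cos_sum R0 c (t x) / M) * cis (t x) powi j)
        = (\<Sum>x<M. \<Sum>l\<in>{- int R0..int R0}. of_real (c l) / (2 * M) *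
            (cis (of_int (j + l) * t x) + cis (of_int (j - l) * t x)))"
    proof (rule sum.cong[OF refl])
      fix x
      have "of_real (cos (of_int l * t x)) * cis (of_int j * t x)
          = (cis (of_int (j + l) * t x) + cis (of_int (j - l) * t x)) / 2" for l
        by (simp add: complex_eq_iff algebra_simps cos_add cos_diff sin_add sin_diff)
      then have "of_real (c l) * of_real (cos (of_int l * t x)) * cis (of_int j * t x) / of_nat M
          = of_real (c l) / (2 * M) * (cis (of_int (j + l) * t x) + cis (of_int (j - l) * t x))" for l
        by (simp only: mult.assoc) simp
      then show "of_real (cos_sum R0 c (t x) / M) * cis (t x) powi j
          = (\<Sum>l\<in>{- int R0..int R0}. of_real (c l) / (2 * M) *
            (cis (of_int (j + l) * t x) + cis (of_int (j - l) * t x)))"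
        by (simp add: cos_sum_def cis_power_int sum_distrib_right sum_divide_distrib mult.assoc)
    qed
    also have "\<dots> = (\<Sum>l\<in>{- int R0..int R0}. of_real (c l) / (2 * M) *
        ((\<Sum>x<M. cis (of_int (j + l) * t x)) + (\<Sum>x<M. cis (of_int (j - l) * t x))))"
      by (subst sum.swap) (simp only: sum_distrib_left[symmetric] sum.distrib)
    \<comment> \<open>Orthogonality leaves \<open>l = j\<close> and \<open>l = - j\<close>, each
      contributing half of \<open>c j\<close> by symmetry; for \<open>j = 0\<close> both halves fall
      on the same \<open>l\<close>.\<close>
    also have "\<dots> = (\<Sum>l\<in>{- int R0..int R0}. (if l = - j then of_real (c l) / 2 else 0)
        + (if l = j then of_real (c l) / 2 else 0))"
    proof (rule sum.cong[OF refl])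
      fix l assume "l \<in> {- int R0..int R0}"
      then have "(\<Sum>x<M. cis (of_int (j + l) * t x)) = (if l = - j then of_nat M else 0)"
        "(\<Sum>x<M. cis (of_int (j - l) * t x)) = (if l = j then of_nat M else 0)"
        using sum_roots_of_unity[OF in_range(1), of l] sum_roots_of_unity[OF in_range(2), of l]
        unfolding t_def by (auto simp: add_eq_0_iff2)
      moreover have "M \<noteq> 0" by (simp add: M_def)
      ultimately show "of_real (c l) / (2 * M) * ((\<Sum>x<M. cis (of_int (j + l) * t x))
          + (\<Sum>x<M. cis (of_int (j - l) * t x)))
        = (if l = - j then of_real (c l) / 2 else 0) + (if l = j then of_real (c l) / 2 else 0)"
        by simp
    qed
    also have "\<dots> = of_real (c j)"
      using even[of j] supp[of j] by (auto simp: sum.distrib)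
    finally show ?thesis .
  qed
  show "\<exists>(M :: nat) w z. (\<forall>x<M. 0 \<le> w x \<and> cmod (z x) = 1) \<and>
    (\<forall>j. \<bar>j\<bar> \<le> R \<longrightarrow> (\<Sum>x<M. of_real (w x) * z x powi j) = of_real (c j))"
    using key nonneg by (intro exI[of _ M] exI[of _ "\<lambda>x. cos_sum R0 c (t x) / M"]
      exI[of _ "\<lambda>x. cis (t x)"]) simp
qed

text \<open>The quadratic form is the integral of the squared modulus of the trigonometric
  polynomial with coefficients \<open>v i\<close> at the frequencies \<open>u i\<close>.\<close>

lemma moment_seq_psd:
  fixes u :: "'a \<Rightarrow> int"
  assumes "moment_seq c" "finite S"
  shows "0 \<le> (\<Sum>i\<in>S. \<Sum>j\<in>S. v i * v j * c (u i - u j))"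
proof -
  define R where "R = 2 * (\<Sum>i\<in>S. \<bar>u i\<bar>)"
  have R: "\<bar>u i - u j\<bar> \<le> R" if "i \<in> S" "j \<in> S" for i j
    using member_le_sum[of i S "\<lambda>i. \<bar>u i\<bar>"] member_le_sum[of j S "\<lambda>i. \<bar>u i\<bar>"] that assms(2)
    unfolding R_def by fastforce
  obtain M :: nat and w z where w: "\<And>x. x < M \<Longrightarrow> 0 \<le> w x"
    and z: "\<And>x. x < M \<Longrightarrow> cmod (z x) = 1"
    and mom: "\<And>j. \<bar>j\<bar> \<le> R \<Longrightarrow> (\<Sum>x<M. of_real (w x) * z x powi j) = of_real (c j)"
    using assms(1) by (rule moment_seqE[where R = R]) (rule that)
  define \<phi> where "\<phi> x = (\<Sum>i\<in>S. of_real (v i) * z x powi u i)" for x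
  have "complex_of_real (v i * v j * c (u i - u j))
      = (\<Sum>x<M. of_real (v i * v j) * (of_real (w x) * z x powi (u i - u j)))"
    if "i \<in> S" "j \<in> S" for i j
    unfolding of_real_mult[of _ "c (u i - u j)"] mom[OF R[OF that], symmetric]
    by (rule sum_distrib_left)
  then have "complex_of_real (\<Sum>i\<in>S. \<Sum>j\<in>S. v i * v j * c (u i - u j))
      = (\<Sum>i\<in>S. \<Sum>j\<in>S. \<Sum>x<M. of_real (v i * v j) * (of_real (w x) * z x powi (u i - u j)))"
    unfolding of_real_sum by (intro sum.cong refl) blast
  also have "\<dots> = (\<Sum>i\<in>S. \<Sum>x<M. \<Sum>j\<in>S. of_real (v i * v j) * (of_real (w x) * z x powi (u i - u j)))"
    by (intro sum.cong[OF refl] sum.swap)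
  also have "\<dots> = (\<Sum>x<M. \<Sum>i\<in>S. \<Sum>j\<in>S. of_real (v i * v j) * (of_real (w x) * z x powi (u i - u j)))"
    by (rule sum.swap)
  also have "\<dots> = (\<Sum>x<M. of_real (w x * (cmod (\<phi> x))\<^sup>2))"
  proof (rule sum.cong[OF refl])
    fix x assume "x \<in> {..<M}"
    then have "cmod (z x) = 1" using z by auto
    then have "z x powi (u i - u j) = z x powi u i * cnj (z x powi u j)" for i j
      by (subst power_int_diff) (auto simp: divide_conv_cnj norm_power_int)
    then have "(\<Sum>i\<in>S. \<Sum>j\<in>S. of_real (v i * v j) * (of_real (w x) * z x powi (u i - u j)))
        = of_real (w x) * (\<phi> x * cnj (\<phi> x))"
      unfolding \<phi>_def cnj_sum sum_product unfolding sum_distrib_left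
      by (intro sum.cong refl) (simp add: mult_ac)
    then show "(\<Sum>i\<in>S. \<Sum>j\<in>S. of_real (v i * v j) * (of_real (w x) * z x powi (u i - u j)))
        = of_real (w x * (cmod (\<phi> x))\<^sup>2)"
      by (simp only: of_real_mult complex_norm_square)
  qed
  finally have "(\<Sum>i\<in>S. \<Sum>j\<in>S. v i * v j * c (u i - u j)) = (\<Sum>x<M. w x * (cmod (\<phi> x))\<^sup>2)"
    unfolding of_real_sum[symmetric] of_real_eq_iff .
  also have "\<dots> \<ge> 0" using w by (intro sum_nonneg) simp
  finally show ?thesis .
qed

section \<open>Windows of zeros\<close>

lemma power_int_minus_eq_cnj:
  assumes "cmod z = 1"
  shows "z powi (- j) = cnj (z powi j)"
proof -
  have "cmod (z powi j) = 1" using assms by (simp add: norm_power_int)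
  then show ?thesis
    unfolding power_int_minus inverse_eq_divide by (subst divide_conv_cnj) simp_all
qed

lemma moment_seq_even:
  assumes "moment_seq c"
  shows "c (- j) = c j"
proof -
  obtain M :: nat and w z where z: "\<And>x. x < M \<Longrightarrow> cmod (z x) = 1"
    and mom: "\<And>i. \<bar>i\<bar> \<le> \<bar>j\<bar> \<Longrightarrow> (\<Sum>x<M. of_real (w x) * z x powi i) = of_real (c i)"
    using assms by (rule moment_seqE[where R = "\<bar>j\<bar>"]) (rule that)
  have "z x powi (- j) = cnj (z x powi j)" if "x < M" for x
    using z[OF that] by (rule power_int_minus_eq_cnj)
  then have "complex_of_real (c (- j)) = cnj (of_real (c j))"
    using mom[of j] mom[of "- j"] by (simp flip: mom add: cnj_sum)
  then show ?thesis by simp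
qed

section \<open>Averages and weighted Cauchy-Schwarz inequalities\<close>

definition avg :: "nat \<Rightarrow> (nat \<Rightarrow> complex) \<Rightarrow> complex" where
  "avg M f = (\<Sum>i<M. f i) / of_nat M"

lemma avg_mult_left: "a * avg M f = avg M (\<lambda>i. a * f i)"
  by (simp add: avg_def sum_distrib_left)

lemma avg_mult_right: "avg M f * a = avg M (\<lambda>i. f i * a)"
  by (simp add: avg_def sum_distrib_right)

lemma avg_diff: "avg M f - avg M g = avg M (\<lambda>i. f i - g i)"
  by (simp add: avg_def sum_subtractf diff_divide_distrib)

lemma cnj_avg: "cnj (avg M f) = avg M (\<lambda>i. cnj (f i))"
  by (simp add: avg_def cnj_sum)

lemma avg_const: "M > 0 \<Longrightarrow> avg M (\<lambda>_. a) = a"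
  by (simp add: avg_def)

lemma norm_avg_le_sum: "norm (avg M f) \<le> (\<Sum>i<M. norm (f i)) / M"
  by (simp add: avg_def norm_divide divide_right_mono norm_sum)

lemma norm_avg_le:
  assumes "M > 0" "\<And>i. i < M \<Longrightarrow> norm (f i) \<le> B"
  shows "norm (avg M f) \<le> B"
proof -
  have "(\<Sum>i<M. norm (f i)) \<le> real M * B"
    using sum_bounded_above[of "{..<M}" "\<lambda>i. norm (f i)" B] assms(2) by simp
  then have "(\<Sum>i<M. norm (f i)) / M \<le> B"
    using assms(1) by (simp add: divide_le_eq mult.commute)
  then show ?thesis using norm_avg_le_sum[of M f] by linarith
qed

lemma sum_avg: "(\<Sum>x\<in>X. a x * avg M (f x)) = avg M (\<lambda>i. \<Sum>x\<in>X. a x * f x i)"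
  unfolding avg_mult_left unfolding avg_def sum_divide_distrib[symmetric]
  by (subst sum.swap) (rule refl)

lemma weighted_cauchy_schwarz:
  fixes w g :: "'a \<Rightarrow> real"
  assumes "\<And>x. x \<in> X \<Longrightarrow> 0 \<le> w x"
  shows "(\<Sum>x\<in>X. w x * g x)\<^sup>2 \<le> (\<Sum>x\<in>X. w x) * (\<Sum>x\<in>X. w x * (g x)\<^sup>2)"
proof -
  have "(\<Sum>x\<in>X. sqrt (w x) * (sqrt (w x) * g x))\<^sup>2
      \<le> (\<Sum>x\<in>X. (sqrt (w x))\<^sup>2) * (\<Sum>x\<in>X. (sqrt (w x) * g x)\<^sup>2)"
    by (rule Cauchy_Schwarz_ineq_sum)
  moreover have "(\<Sum>x\<in>X. sqrt (w x) * (sqrt (w x) * g x)) = (\<Sum>x\<in>X. w x * g x)"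
    using assms by (intro sum.cong refl) (simp flip: mult.assoc)
  moreover have "(\<Sum>x\<in>X. (sqrt (w x))\<^sup>2) = (\<Sum>x\<in>X. w x)"
    using assms by (intro sum.cong refl) simp
  moreover have "(\<Sum>x\<in>X. (sqrt (w x) * g x)\<^sup>2) = (\<Sum>x\<in>X. w x * (g x)\<^sup>2)"
    using assms by (intro sum.cong refl) (simp add: power_mult_distrib)
  ultimately show ?thesis by simp
qed

lemma norm_weighted_le:
  fixes w :: "'a \<Rightarrow> real" and f g :: "'a \<Rightarrow> complex"
  assumes w: "\<And>x. x \<in> X \<Longrightarrow> 0 \<le> w x" and f: "\<And>x. x \<in> X \<Longrightarrow> norm (f x) \<le> 1"
  shows "norm (\<Sum>x\<in>X. of_real (w x) * (f x * g x))
    \<le> sqrt ((\<Sum>x\<in>X. w x) * (\<Sum>x\<in>X. w x * (norm (g x))\<^sup>2))"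
proof (rule real_le_rsqrt)
  have "norm (\<Sum>x\<in>X. of_real (w x) * (f x * g x)) \<le> (\<Sum>x\<in>X. norm (of_real (w x) * (f x * g x)))"
    by (rule norm_sum)
  also have "\<dots> \<le> (\<Sum>x\<in>X. w x * norm (g x))"
  proof (rule sum_mono)
    fix x assume x: "x \<in> X"
    have "norm (f x) * norm (g x) \<le> 1 * norm (g x)"
      using f[OF x] by (intro mult_right_mono) auto
    then show "norm (of_real (w x) * (f x * g x)) \<le> w x * norm (g x)"
      using w[OF x] by (simp add: norm_mult mult_left_mono)
  qed
  finally have "(norm (\<Sum>x\<in>X. of_real (w x) * (f x * g x)))\<^sup>2 \<le> (\<Sum>x\<in>X. w x * norm (g x))\<^sup>2"
    by (intro power_mono) auto
  also have "\<dots> \<le> (\<Sum>x\<in>X. w x) * (\<Sum>x\<in>X. w x * (norm (g x))\<^sup>2)"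
    using w by (rule weighted_cauchy_schwarz)
  finally show "(norm (\<Sum>x\<in>X. of_real (w x) * (f x * g x)))\<^sup>2
    \<le> (\<Sum>x\<in>X. w x) * (\<Sum>x\<in>X. w x * (norm (g x))\<^sup>2)" .
qed

text \<open>With \<open>E\<^sub>0, E\<^sub>1, E\<^sub>2, E\<^sub>3\<close> the averages of \<open>z powi m i\<close> over four consecutive blocks of
  indices, \<open>gram\<close> makes the \<open>E\<^sub>g\<close> close to each other in \<open>L\<^sup>2\<close>. By \<open>zero\<close>,
  \<open>E\<^sub>2 (cnj E\<^sub>1)\<^sup>2 z\<^sup>N\<close> has integral \<open>0\<close>; by closeness so has almost
  \<open>E\<^sub>0 (cnj E\<^sub>1)\<^sup>2 z\<^sup>N\<close>, by \<open>pair\<close> also \<open>E\<^sub>0 (cnj E\<^sub>1)\<^sup>2 E\<^sub>3\<close>, and by closeness again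
  \<open>\<bar>E\<^sub>0\<bar>\<^sup>4\<close>. Hoelder's inequality then bounds the integral of \<open>E\<^sub>0 z\<^sup>x\<close>, which is nearly
  \<open>\<beta>\<close>.\<close>

lemma moment_seq_fourth_power:
  fixes c :: "int \<Rightarrow> real" and m :: "nat \<Rightarrow> int"
  assumes c: "moment_seq c" and M: "M > 0"
    and gram: "\<And>i l. i < l \<Longrightarrow> l < 4 * M \<Longrightarrow> \<bar>c (m l - m i) - \<gamma>\<bar> \<le> e"
    and pair: "\<And>i k l d. i < M \<Longrightarrow> k < M \<Longrightarrow> l < M \<Longrightarrow> d < M \<Longrightarrow>
      \<bar>c (N + (m i - m (M + k) - m (M + l))) - c (m (3 * M + d) + (m i - m (M + k) - m (M + l)))\<bar> \<le> e"
    and zero: "\<And>i k l. i < M \<Longrightarrow> k < M \<Longrightarrow> l < M \<Longrightarrow>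
      c (N + (m (2 * M + i) - m (M + k) - m (M + l))) = 0"
    and point: "\<And>i. i < M \<Longrightarrow> \<bar>c (m i + x) - \<beta>\<bar> \<le> e" and e: "0 \<le> e"
  shows "\<bar>\<beta>\<bar> \<le> e \<or>
    (\<bar>\<beta>\<bar> - e) ^ 4 \<le> c 0 ^ 3 * (e + 4 * sqrt (c 0 * (2 * (c 0 + \<bar>\<gamma>\<bar>) / M + 4 * e)))"
proof -
  define S where "S = (\<Sum>i<4 * M. \<bar>m i\<bar>)"
  have S: "\<bar>m i\<bar> \<le> S" if "i < 4 * M" for i
    unfolding S_def using that by (intro member_le_sum) auto
  \<comment> \<open>Every frequency met below combines at most four of the \<open>m i\<close> with
    at most one of \<open>N\<close> and \<open>x\<close>, so \<open>c\<close> gives its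
    moment.\<close>
  define R where "R = \<bar>N\<bar> + \<bar>x\<bar> + 4 * S"
  obtain P :: nat and w z where w: "\<And>x. x < P \<Longrightarrow> 0 \<le> w x" and z: "\<And>x. x < P \<Longrightarrow> cmod (z x) = 1"
    and mom: "\<And>j. \<bar>j\<bar> \<le> R \<Longrightarrow> (\<Sum>x<P. of_real (w x) * z x powi j) = of_real (c j)"
    using c by (rule moment_seqE[where R = R]) (rule that)
  define L :: "(nat \<Rightarrow> complex) \<Rightarrow> complex" where "L f = (\<Sum>x<P. of_real (w x) * f x)" for f
  define E where "E g x = avg M (\<lambda>i. z x powi m (g * M + i))" for g x
  define s where "s = sqrt (c 0 * (2 * (c 0 + \<bar>\<gamma>\<bar>) / M + 4 * e))"
  have L_cong: "L f = L g" if "\<And>x. x < P \<Longrightarrow> f x = g x" for f g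
    unfolding L_def using that by (intro sum.cong) auto
  have L_diff: "L (\<lambda>x. f x - g x) = L f - L g" for f g
    by (simp add: L_def algebra_simps sum_subtractf)
  have L_add: "L (\<lambda>x. f x + g x) = L f + L g" for f g
    by (simp add: L_def algebra_simps sum.distrib)
  have L_avg: "L (\<lambda>x. avg M (f x)) = avg M (\<lambda>i. L (\<lambda>x. f x i))" for f
    unfolding L_def by (rule sum_avg)
  have L_mom: "L (\<lambda>x. z x powi j) = of_real (c j)" if "\<bar>j\<bar> \<le> R" for j
    unfolding L_def using mom[OF that] .
  have "0 \<le> S" unfolding S_def by (intro sum_nonneg) simp
  have mass: "(\<Sum>x<P. w x) = c 0"
  proof -
    have "complex_of_real (\<Sum>x<P. w x) = of_real (c 0)"
      using mom[of 0] \<open>0 \<le> S\<close> by (simp add: R_def)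
    then show ?thesis by (simp only: of_real_eq_iff)
  qed
  have c0: "0 \<le> c 0" unfolding mass[symmetric] using w by (intro sum_nonneg) auto
  have z_add: "z x powi (i + j) = z x powi i * z x powi j" if "x < P" for x i j
    using z[OF that] by (intro power_int_add) auto
  have z_uminus: "z x powi (- j) = cnj (z x powi j)" if "x < P" for x j
    using z[OF that] by (rule power_int_minus_eq_cnj)
  have z_diff: "z x powi (i - j) = z x powi i * cnj (z x powi j)" if "x < P" for x i j
    using z_add[OF that, of i "- j"] z_uminus[OF that] by simp
  have E_le: "norm (E g x) \<le> 1" if "x < P" for g x
    unfolding E_def using M z[OF that] by (intro norm_avg_le) (auto simp: norm_power_int)
  have index: "g * M + i < 4 * M" if "g < 4" "i < M" for g i
  proof -
    have "g * M \<le> 3 * M" using that(1) by (intro mult_le_mono1) simp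
    then show ?thesis using that(2) by linarith
  qed
  have inner: "L (\<lambda>x. E g x * cnj (E h x)) = avg M (\<lambda>i. avg M (\<lambda>k. of_real (c (m (g * M + i) - m (h * M + k)))))"
    if "g < 4" "h < 4" for g h
  proof -
    have "L (\<lambda>x. E g x * cnj (E h x))
        = L (\<lambda>x. avg M (\<lambda>i. avg M (\<lambda>k. z x powi (m (g * M + i) - m (h * M + k)))))"
      by (rule L_cong, simp only: E_def cnj_avg avg_mult_right) (simp only: avg_mult_left z_diff)
    also have "\<dots> = avg M (\<lambda>i. avg M (\<lambda>k. L (\<lambda>x. z x powi (m (g * M + i) - m (h * M + k)))))"
      by (simp add: L_avg)
    also have "\<dots> = avg M (\<lambda>i. avg M (\<lambda>k. of_real (c (m (g * M + i) - m (h * M + k)))))"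
      unfolding avg_def
    proof (intro arg_cong2[where f = "(/)"] sum.cong refl L_mom)
      fix i k assume "i \<in> {..<M}" "k \<in> {..<M}"
      then have "g * M + i < 4 * M" "h * M + k < 4 * M"
        using that by (auto intro: index)
      then show "\<bar>m (g * M + i) - m (h * M + k)\<bar> \<le> R"
        using S \<open>0 \<le> S\<close> unfolding R_def by smt
    qed
    finally show ?thesis .
  qed
  have gram': "\<bar>c (m l - m i) - \<gamma>\<bar> \<le> e" if "i \<noteq> l" "i < 4 * M" "l < 4 * M" for i l
    using that gram[of i l] gram[of l i] moment_seq_even[OF c, of "m i - m l"]
    by (cases i l rule: linorder_cases) auto
  \<comment> \<open>Off the diagonal all Gram entries are within \<open>e\<close> of
    \<open>\<gamma>\<close>. The diagonal, met only when the two blocks coincide, is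
    \<open>M\<close> entries out of \<open>M ^ 2\<close> and costs a term of order
    \<open>1 / M\<close>.\<close>
  have inner_close: "norm (L (\<lambda>x. E g x * cnj (E h x)) - of_real \<gamma>) \<le> (if g = h then (c 0 + \<bar>\<gamma>\<bar>) / M else 0) + e"
    if gh: "g < 4" "h < 4" for g h
  proof -
    have "L (\<lambda>x. E g x * cnj (E h x)) - of_real \<gamma>
        = avg M (\<lambda>i. avg M (\<lambda>k. of_real (c (m (g * M + i) - m (h * M + k)) - \<gamma>)))"
      using avg_diff[of M "\<lambda>i. avg M _" "\<lambda>i. of_real \<gamma>"] avg_diff[of M _ "\<lambda>i. of_real \<gamma>"]
      by (simp add: inner[OF gh] avg_const[OF M])
    also have "norm \<dots> \<le> (if g = h then (c 0 + \<bar>\<gamma>\<bar>) / M else 0) + e"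
    proof (rule norm_avg_le[OF M])
      fix i assume i: "i < M"
      have "norm (avg M (\<lambda>k. of_real (c (m (g * M + i) - m (h * M + k)) - \<gamma>)))
          \<le> (\<Sum>k<M. \<bar>c (m (g * M + i) - m (h * M + k)) - \<gamma>\<bar>) / M"
        using norm_avg_le_sum[of M "\<lambda>k. of_real (c (m (g * M + i) - m (h * M + k)) - \<gamma>)"]
        by (simp only: norm_of_real)
      also have "\<dots> \<le> (\<Sum>k<M. (if g = h \<and> k = i then c 0 + \<bar>\<gamma>\<bar> else 0) + e) / M"
      proof (intro divide_right_mono sum_mono)
        fix k assume "k \<in> {..<M}"
        then have lt: "g * M + i < 4 * M" "h * M + k < 4 * M"
          using gh i by (auto intro: index)
        have neq: "g * M + i \<noteq> h * M + k" if "\<not> (g = h \<and> k = i)"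
        proof
          assume eq: "g * M + i = h * M + k"
          have "(g * M + i) div M = g" "(h * M + k) div M = h"
            using i \<open>k \<in> {..<M}\<close> by simp_all
          with eq that show False by auto
        qed
        show "\<bar>c (m (g * M + i) - m (h * M + k)) - \<gamma>\<bar> \<le> (if g = h \<and> k = i then c 0 + \<bar>\<gamma>\<bar> else 0) + e"
          using gram'[of "h * M + k" "g * M + i"] neq lt e c0 by auto
      qed simp
      also have "\<dots> = (if g = h then (c 0 + \<bar>\<gamma>\<bar>) / M else 0) + e"
        using i M by (simp add: sum.distrib add_divide_distrib)
      finally show "norm (avg M (\<lambda>k. of_real (c (m (g * M + i) - m (h * M + k)) - \<gamma>)))
          \<le> (if g = h then (c 0 + \<bar>\<gamma>\<bar>) / M else 0) + e" .
    qed
    finally show ?thesis .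
  qed
  \<comment> \<open>Expanding the square gives four inner products near the same
    \<open>\<gamma>\<close>, which cancels.\<close>
  have close: "(\<Sum>x<P. w x * (norm (E g x - E h x))\<^sup>2) \<le> 2 * (c 0 + \<bar>\<gamma>\<bar>) / M + 4 * e"
    if gh: "g < 4" "h < 4" "g \<noteq> h" for g h
  proof -
    let ?I = "\<lambda>g h. L (\<lambda>x. E g x * cnj (E h x))"
    have "complex_of_real (\<Sum>x<P. w x * (norm (E g x - E h x))\<^sup>2)
        = L (\<lambda>x. (E g x - E h x) * cnj (E g x - E h x))"
      unfolding L_def of_real_sum of_real_mult complex_norm_square ..
    also have "\<dots> = L (\<lambda>x. E g x * cnj (E g x) - E g x * cnj (E h x) - E h x * cnj (E g x) + E h x * cnj (E h x))"
      by (rule L_cong) (simp add: algebra_simps)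
    also have "\<dots> = (?I g g - of_real \<gamma>) - (?I g h - of_real \<gamma>) - (?I h g - of_real \<gamma>) + (?I h h - of_real \<gamma>)"
      by (simp add: L_add L_diff)
    finally have eq: "complex_of_real (\<Sum>x<P. w x * (norm (E g x - E h x))\<^sup>2) = \<dots>" .
    have "(\<Sum>x<P. w x * (norm (E g x - E h x))\<^sup>2)
        \<le> norm (complex_of_real (\<Sum>x<P. w x * (norm (E g x - E h x))\<^sup>2))"
      unfolding norm_of_real by simp
    also have "\<dots> \<le> norm (?I g g - of_real \<gamma>) + norm (?I g h - of_real \<gamma>)
        + norm (?I h g - of_real \<gamma>) + norm (?I h h - of_real \<gamma>)"
      unfolding eq by (intro norm_triangle_mono norm_triangle_le_diff add_mono order_refl)
    also have "\<dots> \<le> ((c 0 + \<bar>\<gamma>\<bar>) / M + e) + e + e + ((c 0 + \<bar>\<gamma>\<bar>) / M + e)"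
      using inner_close[of g g] inner_close[of g h] inner_close[of h g] inner_close[of h h] gh
      by (intro add_mono) auto
    finally show ?thesis by (simp add: add_divide_distrib)
  qed
  \<comment> \<open>Exchanging one block average for another, next to a factor bounded by 1, costs
    at most \<open>s\<close>.\<close>
  have swap: "norm (L (\<lambda>x. f x * d x)) \<le> s"
    if "\<And>x. x < P \<Longrightarrow> norm (f x) \<le> 1" "\<And>x. norm (d x) = norm (E g x - E h x)"
      "g < 4" "h < 4" "g \<noteq> h" for f d g h
  proof -
    have "norm (L (\<lambda>x. f x * d x)) \<le> sqrt ((\<Sum>x<P. w x) * (\<Sum>x<P. w x * (norm (d x))\<^sup>2))"
      unfolding L_def using w that(1) by (intro norm_weighted_le) auto
    also have "\<dots> \<le> s"
      unfolding s_def mass that(2) using close[OF that(3-5)] c0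
      by (intro real_sqrt_le_mono mult_left_mono)
    finally show ?thesis .
  qed
  let ?B = "\<lambda>x. cnj (E 1 x) * cnj (E 1 x)"
  have near: "norm (L (\<lambda>x. E 0 x * ?B x * (z x powi N - E 3 x))) \<le> e"
  proof -
    let ?y = "\<lambda>i k l. m i - m (M + k) - m (M + l)"
    have "L (\<lambda>x. E 0 x * ?B x * (z x powi N - E 3 x))
        = L (\<lambda>x. avg M (\<lambda>i. avg M (\<lambda>k. avg M (\<lambda>l. avg M (\<lambda>d.
            z x powi (N + ?y i k l) - z x powi (m (3 * M + d) + ?y i k l))))))"
    proof (rule L_cong)
      fix x assume x: "x < P"
      have "z x powi N - E 3 x = avg M (\<lambda>d. z x powi N - z x powi m (3 * M + d))"
        using avg_diff[of M "\<lambda>_. z x powi N"] by (simp add: E_def avg_const[OF M])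
      then have "E 0 x * ?B x * (z x powi N - E 3 x) = avg M (\<lambda>i. avg M (\<lambda>k. avg M (\<lambda>l. avg M (\<lambda>d.
          z x powi m i * (cnj (z x powi m (M + k)) * (cnj (z x powi m (M + l)) *
          (z x powi N - z x powi m (3 * M + d))))))))"
        by (simp only: mult.assoc) (simp only: E_def cnj_avg avg_mult_right, simp only: avg_mult_left mult_1 mult_0 add_0)
      then show "E 0 x * ?B x * (z x powi N - E 3 x) = avg M (\<lambda>i. avg M (\<lambda>k. avg M (\<lambda>l. avg M (\<lambda>d.
            z x powi (N + ?y i k l) - z x powi (m (3 * M + d) + ?y i k l)))))"
        by (simp only: z_add[OF x] z_diff[OF x]) (simp only: algebra_simps)
    qed
    also have "\<dots> = avg M (\<lambda>i. avg M (\<lambda>k. avg M (\<lambda>l. avg M (\<lambda>d.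
            L (\<lambda>x. z x powi (N + ?y i k l)) - L (\<lambda>x. z x powi (m (3 * M + d) + ?y i k l))))))"
      by (simp only: L_avg L_diff)
    also have "norm \<dots> \<le> e"
    proof (intro norm_avg_le[OF M])
      fix i k l d assume lt: "i < M" "k < M" "l < M" "d < M"
      have "\<bar>m i\<bar> \<le> S" "\<bar>m (M + k)\<bar> \<le> S" "\<bar>m (M + l)\<bar> \<le> S" "\<bar>m (3 * M + d)\<bar> \<le> S"
        using lt by (auto intro!: S)
      then have "\<bar>N + ?y i k l\<bar> \<le> R" "\<bar>m (3 * M + d) + ?y i k l\<bar> \<le> R"
        unfolding R_def by linarith+
      then show "norm (L (\<lambda>x. z x powi (N + ?y i k l)) - L (\<lambda>x. z x powi (m (3 * M + d) + ?y i k l))) \<le> e"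
        using pair[OF lt] by (simp only: L_mom of_real_diff[symmetric] norm_of_real)
    qed
    finally show ?thesis .
  qed
  have vanish: "L (\<lambda>x. E 2 x * ?B x * z x powi N) = 0"
  proof -
    let ?y = "\<lambda>i k l. m (2 * M + i) - m (M + k) - m (M + l)"
    have "L (\<lambda>x. E 2 x * ?B x * z x powi N)
        = L (\<lambda>x. avg M (\<lambda>i. avg M (\<lambda>k. avg M (\<lambda>l. z x powi (N + ?y i k l)))))"
    proof (rule L_cong)
      fix x assume x: "x < P"
      have "E 2 x * ?B x * z x powi N = avg M (\<lambda>i. avg M (\<lambda>k. avg M (\<lambda>l.
          z x powi m (2 * M + i) * (cnj (z x powi m (M + k)) * (cnj (z x powi m (M + l)) * z x powi N)))))"
        by (simp only: mult.assoc) (simp only: E_def cnj_avg avg_mult_right, simp only: avg_mult_left mult_1 mult_0 add_0)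
      then show "E 2 x * ?B x * z x powi N = avg M (\<lambda>i. avg M (\<lambda>k. avg M (\<lambda>l. z x powi (N + ?y i k l))))"
        by (simp only: z_add[OF x] z_diff[OF x]) (simp only: algebra_simps)
    qed
    also have "\<dots> = avg M (\<lambda>i. avg M (\<lambda>k. avg M (\<lambda>l. L (\<lambda>x. z x powi (N + ?y i k l)))))"
      by (simp only: L_avg)
    also have "norm \<dots> \<le> 0"
    proof (intro norm_avg_le[OF M])
      fix i k l assume lt: "i < M" "k < M" "l < M"
      have "\<bar>m (2 * M + i)\<bar> \<le> S" "\<bar>m (M + k)\<bar> \<le> S" "\<bar>m (M + l)\<bar> \<le> S"
        using lt by (auto intro!: S)
      then have "\<bar>N + ?y i k l\<bar> \<le> R" unfolding R_def by linarith
      then show "norm (L (\<lambda>x. z x powi (N + ?y i k l))) \<le> 0"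
        using zero[OF lt] by (simp only: L_mom) simp
    qed
    finally show ?thesis by simp
  qed
  have prod_le: "norm (a * b) \<le> 1" if "norm a \<le> 1" "norm b \<le> 1" for a b :: complex
    using that by (simp add: norm_mult mult_le_one)
  have zN: "norm (z x powi N) \<le> 1" if "x < P" for x
    using z[OF that] by (simp add: norm_power_int)
  have cE: "norm (cnj (E g x)) \<le> 1" if "x < P" for g x
    using E_le[OF that] by simp
  have fourth: "(\<Sum>x<P. w x * (norm (E 0 x)) ^ 4) \<le> e + 4 * s"
  proof -
    have 1: "norm (L (\<lambda>x. (?B x * z x powi N) * (E 0 x - E 2 x))) \<le> s"
      by (rule swap[of _ _ 0 2]) (auto intro!: prod_le zN cE)
    have 2: "norm (L (\<lambda>x. (E 0 x * (cnj (E 0 x) * cnj (E 0 x))) * (E 0 x - E 3 x))) \<le> s"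
      by (rule swap[of _ _ 0 3]) (auto intro!: prod_le E_le cE)
    have 3: "norm (L (\<lambda>x. (E 0 x * cnj (E 0 x) * E 3 x) * cnj (E 0 x - E 1 x))) \<le> s"
      by (rule swap[of _ _ 0 1]) (auto intro!: prod_le E_le cE simp del: complex_cnj_diff)
    have 4: "norm (L (\<lambda>x. (E 0 x * cnj (E 1 x) * E 3 x) * cnj (E 0 x - E 1 x))) \<le> s"
      by (rule swap[of _ _ 0 1]) (auto intro!: prod_le E_le cE simp del: complex_cnj_diff)
    have "complex_of_real (\<Sum>x<P. w x * (norm (E 0 x)) ^ 4)
        = L (\<lambda>x. (E 0 x * cnj (E 0 x)) * (E 0 x * cnj (E 0 x)))"
      unfolding L_def of_real_sum of_real_mult complex_norm_square[symmetric]
      by (intro sum.cong refl) (simp add: power_mult[symmetric] power_add[symmetric])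
    \<comment> \<open>A telescoping identity: four exchanges of averages at cost \<open>s\<close>
      each, the integral that vanishes, and the replacement of \<open>z powi N\<close> by
      \<open>E 3\<close> at cost \<open>e\<close>.\<close>
    also have "\<dots> = L (\<lambda>x. (E 0 x * (cnj (E 0 x) * cnj (E 0 x))) * (E 0 x - E 3 x)
        + (E 0 x * cnj (E 0 x) * E 3 x) * cnj (E 0 x - E 1 x)
        + (E 0 x * cnj (E 1 x) * E 3 x) * cnj (E 0 x - E 1 x)
        + (?B x * z x powi N) * (E 0 x - E 2 x)
        + E 2 x * ?B x * z x powi N
        - E 0 x * ?B x * (z x powi N - E 3 x))"
      by (rule L_cong) (simp add: algebra_simps)
    finally have eq: "complex_of_real (\<Sum>x<P. w x * (norm (E 0 x)) ^ 4) = \<dots>" .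
    have "(\<Sum>x<P. w x * (norm (E 0 x)) ^ 4)
        \<le> norm (complex_of_real (\<Sum>x<P. w x * (norm (E 0 x)) ^ 4))"
      unfolding norm_of_real by simp
    also have "\<dots> \<le> s + s + s + s + norm (0 :: complex) + e"
      unfolding eq L_add L_diff vanish
      by (intro norm_triangle_mono norm_triangle_le_diff add_mono 1 2 3 4 near order_refl)
    finally show ?thesis by simp
  qed
  have pt: "\<bar>\<beta>\<bar> - e \<le> (\<Sum>x<P. w x * norm (E 0 x))"
  proof -
    have "L (\<lambda>y. E 0 y * z y powi x) = L (\<lambda>y. avg M (\<lambda>i. z y powi (m i + x)))"
      by (rule L_cong) (simp add: E_def avg_mult_right z_add)
    then have "L (\<lambda>y. E 0 y * z y powi x) - of_real \<beta>
        = avg M (\<lambda>i. L (\<lambda>y. z y powi (m i + x)) - of_real \<beta>)"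
      using avg_diff[of M _ "\<lambda>_. of_real \<beta>"] by (simp add: L_avg avg_const[OF M])
    also have "norm \<dots> \<le> e"
    proof (rule norm_avg_le[OF M])
      fix i assume i: "i < M"
      then have "\<bar>m i\<bar> \<le> S" by (intro S) simp
      then have "\<bar>m i + x\<bar> \<le> R" unfolding R_def by linarith
      then show "norm (L (\<lambda>y. z y powi (m i + x)) - of_real \<beta>) \<le> e"
        using point[OF i] by (simp only: L_mom of_real_diff[symmetric] norm_of_real)
    qed
    finally have "norm (L (\<lambda>y. E 0 y * z y powi x) - of_real \<beta>) \<le> e" .
    then have "\<bar>\<beta>\<bar> - e \<le> norm (L (\<lambda>y. E 0 y * z y powi x))"
      using norm_triangle_ineq2[of "of_real \<beta>" "L (\<lambda>y. E 0 y * z y powi x)"]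
      by (simp add: norm_minus_commute)
    also have "\<dots> \<le> (\<Sum>y<P. norm (of_real (w y) * (E 0 y * z y powi x)))"
      unfolding L_def by (rule norm_sum)
    also have "\<dots> = (\<Sum>y<P. w y * norm (E 0 y))"
      using w z by (intro sum.cong) (auto simp: norm_mult norm_power_int)
    finally show ?thesis .
  qed
  show ?thesis
  proof (cases "\<bar>\<beta>\<bar> \<le> e")
    case False
    \<comment> \<open>Two applications of the Cauchy-Schwarz inequality yield the Hoelder bound
      between the first and the fourth moment of \<open>norm (E 0 x)\<close>.\<close>
    have "(\<bar>\<beta>\<bar> - e) ^ 4 \<le> (\<Sum>x<P. w x * norm (E 0 x)) ^ 4"
      using pt False by (intro power_mono) auto
    also have "\<dots> = ((\<Sum>x<P. w x * norm (E 0 x))\<^sup>2)\<^sup>2" by simp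
    also have "\<dots> \<le> (c 0 * (\<Sum>x<P. w x * (norm (E 0 x))\<^sup>2))\<^sup>2"
      unfolding mass[symmetric] using w by (intro power_mono weighted_cauchy_schwarz) auto
    also have "\<dots> = c 0 ^ 2 * (\<Sum>x<P. w x * (norm (E 0 x))\<^sup>2)\<^sup>2"
      by (simp add: power_mult_distrib)
    also have "\<dots> \<le> c 0 ^ 2 * (c 0 * (\<Sum>x<P. w x * ((norm (E 0 x))\<^sup>2)\<^sup>2))"
      unfolding mass[symmetric] using w by (intro mult_left_mono weighted_cauchy_schwarz) auto
    also have "\<dots> = c 0 ^ 3 * (\<Sum>x<P. w x * (norm (E 0 x)) ^ 4)"
      by (simp add: power2_eq_square power3_eq_cube power4_eq_xxxx mult.assoc)
    also have "\<dots> \<le> c 0 ^ 3 * (e + 4 * s)"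
      using fourth c0 by (intro mult_left_mono) auto
    finally show ?thesis by (simp add: s_def)
  qed simp
qed

lemma moment_seq_0_nonneg: "moment_seq c \<Longrightarrow> 0 \<le> c 0"
  using moment_seq_psd[of c "{0 :: int}" "\<lambda>_. 1" "\<lambda>_. 0"] by simp

text \<open>The \<open>m i\<close> fed into the previous lemma are a very sparse subsequence of \<open>n\<close>. The frequency
  \<open>n k + (m i - m (M + l) - m (M + p))\<close> lies below the cut-off \<open>n k\<close>, where \<open>c k\<close> is close to \<open>b\<close>,
  but moves above the cut-off when \<open>m i\<close> is replaced by the larger \<open>m (2 * M + i)\<close>.\<close>

lemma window_limit_eq_0:
  fixes n :: "nat \<Rightarrow> int"
  assumes pd: "\<And>k. moment_seq (c k)" and n: "filterlim n at_top sequentially" and K: "0 \<le> K"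
    and close: "\<And>e. 0 < e \<Longrightarrow> \<forall>\<^sub>F k in sequentially. \<forall>j. \<bar>j\<bar> \<le> n k - K \<longrightarrow> \<bar>c k j - b j\<bar> \<le> e"
    and zero: "\<And>k j. n k + K < j \<Longrightarrow> c k j = 0"
    and lim: "\<And>y. (\<lambda>k. b (n k + y)) \<longlonglongrightarrow> \<beta> y"
    and gamma: "(\<lambda>l. \<beta> (- n l)) \<longlonglongrightarrow> \<gamma>"
  shows "\<beta> x = 0"
proof -
  define C where "C = \<bar>b 0\<bar> + 1"
  define D where "D = 2 * (C + \<bar>\<gamma>\<bar>) + 4"
  have bound: "\<bar>\<beta> x\<bar> \<le> e \<or> (\<bar>\<beta> x\<bar> - e) ^ 4 \<le> C ^ 3 * (e + 4 * sqrt (C * (D * e)))"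
    if e: "0 < e" "e < 1" for e
  proof -
    \<comment> \<open>The hypothesis \<open>pair\<close> accumulates four approximation errors,
      hence the quarter.\<close>
    define \<epsilon> where "\<epsilon> = e / 4"
    have \<epsilon>: "0 < \<epsilon>" "\<epsilon> < 1" using e by (auto simp: \<epsilon>_def)
    obtain M :: nat where M: "1 / e < real M" using reals_Archimedean2 by blast
    then have "0 < real M" using e by (meson less_trans zero_less_divide_1_iff)
    then have M0: "0 < M" by simp
    have Me: "1 / real M \<le> e" using M e \<open>0 < real M\<close> by (simp add: field_simps)
    have large: "\<forall>\<^sub>F k in sequentially. Y < n k" for Y
    proof -
      have "\<forall>\<^sub>F k in sequentially. Y + 1 \<le> n k"
        using n unfolding filterlim_at_top by blast
      then show ?thesis by eventually_elim simp
    qed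
    have tails: "\<forall>\<^sub>F k in sequentially. \<forall>y\<in>{- Y..Y}. \<bar>b (n k + y) - \<beta> y\<bar> \<le> \<epsilon>" for Y
    proof (intro eventually_ball_finite ballI)
      fix y
      show "\<forall>\<^sub>F k in sequentially. \<bar>b (n k + y) - \<beta> y\<bar> \<le> \<epsilon>"
        using tendstoD[OF lim[of y] \<epsilon>(1)] by eventually_elim (simp add: dist_real_def)
    qed simp
    \<comment> \<open>\<open>G\<close> is the demand on a single index, \<open>H\<close> the demand
      on a successor: its frequency is more than three times larger, and its window of radius
      \<open>3 * n k\<close> is already close to the limit.\<close>
    define G where "G k \<longleftrightarrow> K < n k \<and> \<bar>\<beta> (- n k) - \<gamma>\<bar> \<le> \<epsilon> \<and> \<bar>b (n k + x) - \<beta> x\<bar> \<le> \<epsilon>" for k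
    define H where "H k k' \<longleftrightarrow> 3 * n k + K < n k' \<and>
      (\<forall>y\<in>{- (3 * n k)..3 * n k}. \<bar>b (n k' + y) - \<beta> y\<bar> \<le> \<epsilon>)" for k k'
    have evG: "\<forall>\<^sub>F k in sequentially. G k"
      using large[of K] tails[of "\<bar>x\<bar>"] tendstoD[OF gamma \<epsilon>(1)]
    proof eventually_elim
      case (elim k)
      moreover have "x \<in> {- \<bar>x\<bar>..\<bar>x\<bar>}" by auto
      ultimately show ?case by (auto simp: G_def dist_real_def less_imp_le)
    qed
    have evH: "\<forall>\<^sub>F k' in sequentially. H k k'" for k
      using large[of "3 * n k + K"] tails[of "3 * n k"] by eventually_elim (simp add: H_def)
    have "\<exists>f. \<forall>i. G (f i) \<and> H (f i) (f (Suc i))"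
    proof (rule dependent_nat_choice)
      show "\<exists>k. G k" using eventually_happens[OF evG] by simp
      show "\<exists>k'. G k' \<and> H k k'" for k
        using eventually_happens[OF eventually_conj[OF evG evH[of k]]] by simp
    qed
    then obtain f where f: "\<And>i. G (f i)" "\<And>i. H (f i) (f (Suc i))" by blast
    define m where "m i = n (f i)" for i
    have mpos: "K < m i" for i using f(1)[of i] by (simp add: G_def m_def)
    have step: "3 * m i + K < m (Suc i)" for i using f(2)[of i] by (simp add: H_def m_def)
    have mono: "m i \<le> m l" if "i \<le> l" for i l
    proof (rule lift_Suc_mono_le[OF _ that])
      show "m k \<le> m (Suc k)" for k using step[of k] mpos[of k] K by linarith
    qed
    have sparse: "3 * m i + K < m l" and approx: "\<And>y. \<bar>y\<bar> \<le> 3 * m i \<Longrightarrow> \<bar>b (m l + y) - \<beta> y\<bar> \<le> \<epsilon>"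
      if "i < l" for i l
    proof -
      obtain l' where l: "l = Suc l'" "i \<le> l'" using \<open>i < l\<close> by (cases l) auto
      show "3 * m i + K < m l" using mono[OF l(2)] step[of l'] l(1) by simp
      fix y assume "\<bar>y\<bar> \<le> 3 * m i"
      then have "y \<in> {- (3 * n (f l'))..3 * n (f l')}"
        using mono[OF l(2)] by (auto simp: m_def)
      then show "\<bar>b (m l + y) - \<beta> y\<bar> \<le> \<epsilon>"
        using f(2)[of l'] l(1) by (simp add: H_def m_def)
    qed
    \<comment> \<open>The index \<open>k\<close> is chosen last, so that \<open>n k\<close>
      dominates all the \<open>m i\<close> in play.\<close>
    define Y where "Y = 3 * m (4 * M)"
    have "\<forall>\<^sub>F k in sequentially. Y + \<bar>x\<bar> + K < n k \<and> (\<forall>y\<in>{- Y..Y}. \<bar>b (n k + y) - \<beta> y\<bar> \<le> \<epsilon>) \<and>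
        (\<forall>j. \<bar>j\<bar> \<le> n k - K \<longrightarrow> \<bar>c k j - b j\<bar> \<le> \<epsilon>)"
      by (intro eventually_conj large tails close \<epsilon>)
    then obtain k where k: "Y + \<bar>x\<bar> + K < n k" "\<And>y. \<bar>y\<bar> \<le> Y \<Longrightarrow> \<bar>b (n k + y) - \<beta> y\<bar> \<le> \<epsilon>"
      "\<And>j. \<bar>j\<bar> \<le> n k - K \<Longrightarrow> \<bar>c k j - b j\<bar> \<le> \<epsilon>"
      by (auto dest!: eventually_happens simp: abs_le_iff)
    have "\<bar>\<beta> x\<bar> \<le> e \<or>
      (\<bar>\<beta> x\<bar> - e) ^ 4 \<le> c k 0 ^ 3 * (e + 4 * sqrt (c k 0 * (2 * (c k 0 + \<bar>\<gamma>\<bar>) / M + 4 * e)))"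
    proof (rule moment_seq_fourth_power[where m = m and N = "n k" and x = x])
      show "moment_seq (c k)" "M > 0" "0 \<le> e" using pd M0 e by auto
    next
      fix i l assume il: "i < l" "l < 4 * M"
      have "\<bar>m l - m i\<bar> \<le> n k - K"
        using mono[of i l] mono[of l "4 * M"] il mpos[of i] mpos[of "4 * M"] k(1) K unfolding Y_def by linarith
      then have "\<bar>c k (m l - m i) - b (m l - m i)\<bar> \<le> \<epsilon>" by (rule k(3))
      moreover have "\<bar>b (m l - m i) - \<beta> (- m i)\<bar> \<le> \<epsilon>"
        using approx[OF il(1), of "- m i"] mpos[of i] K by simp
      moreover have "\<bar>\<beta> (- m i) - \<gamma>\<bar> \<le> \<epsilon>" using f(1)[of i] by (simp add: G_def m_def)
      ultimately show "\<bar>c k (m l - m i) - \<gamma>\<bar> \<le> e" using \<epsilon>(1) unfolding \<epsilon>_def by linarith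
    next
      fix i l p d assume lt: "i < M" "l < M" "p < M" "d < M"
      define y where "y = m i - m (M + l) - m (M + p)"
      have mb: "3 * m i + K < m (M + l)" "m (M + l) \<le> m (2 * M)" "m (M + p) \<le> m (2 * M)"
        "m (2 * M) \<le> m (4 * M)" "m (3 * M + d) \<le> m (4 * M)"
        using lt by (auto intro!: sparse mono)
      note pos = mpos[of i] mpos[of "M + l"] mpos[of "M + p"] mpos[of "2 * M"] mpos[of "3 * M + d"] K
      have y: "y < - K" "\<bar>y\<bar> \<le> 3 * m (2 * M)" "\<bar>y\<bar> \<le> Y"
        using mb pos unfolding y_def Y_def by linarith+
      have "\<bar>n k + y\<bar> \<le> n k - K" using y k(1) pos by linarith
      then have "\<bar>c k (n k + y) - b (n k + y)\<bar> \<le> \<epsilon>" by (rule k(3))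
      moreover have "\<bar>b (n k + y) - \<beta> y\<bar> \<le> \<epsilon>" using y by (intro k(2))
      moreover have "\<bar>b (m (3 * M + d) + y) - \<beta> y\<bar> \<le> \<epsilon>"
        using y M0 by (intro approx[of "2 * M"]) auto
      moreover have "\<bar>m (3 * M + d) + y\<bar> \<le> n k - K"
        using mb pos k(1) y unfolding Y_def by linarith
      then have "\<bar>c k (m (3 * M + d) + y) - b (m (3 * M + d) + y)\<bar> \<le> \<epsilon>" by (rule k(3))
      ultimately show "\<bar>c k (n k + (m i - m (M + l) - m (M + p)))
          - c k (m (3 * M + d) + (m i - m (M + l) - m (M + p)))\<bar> \<le> e"
        using \<epsilon>(1) unfolding y_def[symmetric] \<epsilon>_def by linarith
    next
      fix i l p assume lt: "i < M" "l < M" "p < M"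
      have "3 * m (M + l) + K < m (2 * M + i)" "3 * m (M + p) + K < m (2 * M + i)"
        using lt by (auto intro!: sparse)
      then show "c k (n k + (m (2 * M + i) - m (M + l) - m (M + p))) = 0"
        using mpos[of "M + l"] mpos[of "M + p"] K by (intro zero) linarith
    next
      fix i assume i: "i < M"
      have "\<bar>m i + x\<bar> \<le> n k - K"
        using mono[of i "4 * M"] i mpos[of i] k(1) K unfolding Y_def by linarith
      then have "\<bar>c k (m i + x) - b (m i + x)\<bar> \<le> \<epsilon>" by (rule k(3))
      moreover have "\<bar>b (m i + x) - \<beta> x\<bar> \<le> \<epsilon>" using f(1)[of i] by (simp add: G_def m_def)
      ultimately show "\<bar>c k (m i + x) - \<beta> x\<bar> \<le> e" using \<epsilon>(1) unfolding \<epsilon>_def by linarith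
    qed
    moreover have c0: "0 \<le> c k 0" using pd by (rule moment_seq_0_nonneg)
    moreover have "\<bar>c k 0 - b 0\<bar> \<le> \<epsilon>"
      using k(1) mpos[of "4 * M"] K by (intro k(3)) (auto simp: Y_def)
    then have cC: "c k 0 \<le> C" using \<epsilon>(2) unfolding C_def by linarith
    moreover have "c k 0 ^ 3 * (e + 4 * sqrt (c k 0 * (2 * (c k 0 + \<bar>\<gamma>\<bar>) / M + 4 * e)))
        \<le> C ^ 3 * (e + 4 * sqrt (C * (D * e)))"
    proof -
      have "2 * (c k 0 + \<bar>\<gamma>\<bar>) / M \<le> 2 * (C + \<bar>\<gamma>\<bar>) * e"
        using mult_mono[of "2 * (c k 0 + \<bar>\<gamma>\<bar>)" "2 * (C + \<bar>\<gamma>\<bar>)" "1 / M" e] cC c0 Me by simp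
      then have "c k 0 * (2 * (c k 0 + \<bar>\<gamma>\<bar>) / M + 4 * e) \<le> C * (D * e)"
        using c0 cC e by (intro mult_mono) (auto simp: D_def algebra_simps)
      then show ?thesis using c0 cC e by (intro mult_mono power_mono) auto
    qed
    ultimately show ?thesis by linarith
  qed
  have "\<bar>\<beta> x\<bar> = 0"
  proof (rule ccontr)
    assume "\<bar>\<beta> x\<bar> \<noteq> 0"
    then have pos: "0 < \<bar>\<beta> x\<bar>" by simp
    \<comment> \<open>Letting \<open>e\<close> tend to 0 turns the bound into
      \<open>\<bar>\<beta> x\<bar> ^ 4 \<le> 0\<close>.\<close>
    have ev: "\<forall>\<^sub>F e in at_right 0. (\<bar>\<beta> x\<bar> - e) ^ 4 \<le> C ^ 3 * (e + 4 * sqrt (C * (D * e)))"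
    proof -
      have "\<forall>\<^sub>F e in at_right (0 :: real). e \<in> {0<..<min 1 \<bar>\<beta> x\<bar>}"
        using pos by (intro eventually_at_right_real) simp
      then show ?thesis
      proof eventually_elim
        case (elim e)
        then show ?case using bound[of e] by auto
      qed
    qed
    have "(\<bar>\<beta> x\<bar> - 0) ^ 4 \<le> C ^ 3 * (0 + 4 * sqrt (C * (D * 0)))"
      by (rule tendsto_le[OF _ _ _ ev]) (auto intro!: tendsto_eq_intros)
    with pos show False by simp
  qed
  then show ?thesis by simp
qed

text \<open>Two passages to subsequences supply the limits presupposed by
  \<open>window_limit_eq_0\<close>: a diagonal one for all shifts of \<open>b\<close>
  simultaneously, then one for \<open>\<beta>\<close> along \<open>- n\<close>.\<close>

lemma moment_seq_window:
  fixes n :: "nat \<Rightarrow> int"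
  assumes pd: "\<And>k. moment_seq (c k)" and n: "filterlim n at_top sequentially" and K: "0 \<le> K"
    and close: "\<And>e. 0 < e \<Longrightarrow> \<forall>\<^sub>F k in sequentially. \<forall>j. \<bar>j\<bar> \<le> n k - K \<longrightarrow> \<bar>c k j - b j\<bar> \<le> e"
    and zero: "\<And>k j. n k + K < j \<Longrightarrow> c k j = 0"
    and bounded: "\<And>j. \<bar>b j\<bar> \<le> B"
  shows "\<exists>r :: nat \<Rightarrow> nat. strict_mono r \<and> (\<forall>x. (\<lambda>k. b (n (r k) + x)) \<longlonglongrightarrow> 0)"
proof -
  obtain r where r: "strict_mono r" "\<And>y. \<exists>l. (\<lambda>k. b (n (r k) + y)) \<longlonglongrightarrow> l"
    using function_convergent_subsequence[of "UNIV :: int set" "\<lambda>k y. b (n k + y)" B] bounded by auto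
  then obtain \<beta> where \<beta>: "\<And>y. (\<lambda>k. b (n (r k) + y)) \<longlonglongrightarrow> \<beta> y" by metis
  have "\<bar>\<beta> y\<bar> \<le> B" for y
    using tendsto_rabs[OF \<beta>[of y]] bounded by (intro LIMSEQ_le_const2) auto
  then have "bounded (range (\<lambda>l. \<beta> (- n (r l))))"
    by (auto simp: bounded_iff)
  then obtain \<gamma> s where s: "strict_mono s" "((\<lambda>l. \<beta> (- n (r l))) \<circ> s) \<longlonglongrightarrow> \<gamma>"
    using bounded_imp_convergent_subsequence by blast
  have rs: "strict_mono (r \<circ> s)" using r(1) s(1) by (rule strict_mono_o)
  have lim: "(\<lambda>k. b (n ((r \<circ> s) k) + y)) \<longlonglongrightarrow> \<beta> y" for y
    using LIMSEQ_subseq_LIMSEQ[OF \<beta> s(1), of y] by (simp add: o_def)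
  have "\<beta> x = 0" for x
  proof (rule window_limit_eq_0[where c = "\<lambda>k. c ((r \<circ> s) k)" and n = "\<lambda>k. n ((r \<circ> s) k)" and b = b and \<beta> = \<beta>])
    show "filterlim (\<lambda>k. n ((r \<circ> s) k)) at_top sequentially"
      by (rule filterlim_compose[OF n filterlim_subseq[OF rs]])
    show "\<forall>\<^sub>F k in sequentially. \<forall>j. \<bar>j\<bar> \<le> n ((r \<circ> s) k) - K \<longrightarrow> \<bar>c ((r \<circ> s) k) j - b j\<bar> \<le> e"
      if "0 < e" for e
      using close[OF that] filterlim_subseq[OF rs] by (rule eventually_compose_filterlim)
    show "(\<lambda>l. \<beta> (- n ((r \<circ> s) l))) \<longlonglongrightarrow> \<gamma>" using s(2) by (simp add: o_def)
  qed (use pd K zero lim in auto)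
  then show ?thesis using rs lim by auto
qed

section \<open>Gaps in positive definite sequences\<close>

text \<open>View \<open>b\<close> as a Gram kernel. At sparse points \<open>s k\<close> preceded by
  long zero gaps the vectors are orthogonal with squared norm \<open>b 0\<close>, yet each
  correlates with the vector at 0 by at least \<open>\<delta>\<close> in modulus. Bessel's
  inequality forbids too many of them.\<close>

lemma psd_gap:
  fixes b :: "int \<Rightarrow> real"
  assumes psd: "\<And>(n :: nat) v u. 0 \<le> (\<Sum>i<n. \<Sum>j<n. v i * v j * b (u i - u j))"
    and even: "\<And>j. b (- j) = b j"
    and \<delta>: "0 < \<delta>" "\<And>j. b j \<noteq> 0 \<Longrightarrow> \<delta> \<le> \<bar>b j\<bar>"
    and window: "\<And>L. \<exists>p\<ge>L. \<forall>j. \<bar>j - p\<bar> \<le> L \<longrightarrow> b j = 0"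
  shows "\<exists>J. \<forall>j>J. b j = 0"
proof (rule ccontr)
  assume "\<not> ?thesis"
  then have inf: "\<exists>j>J. b j \<noteq> 0" for J by blast
  \<comment> \<open>The first nonzero value after the centre of a zero window of radius
    \<open>L\<close> has at least \<open>L\<close> zeros directly before it.\<close>
  have gap: "\<exists>s>L. b s \<noteq> 0 \<and> (\<forall>j. s - L \<le> j \<longrightarrow> j < s \<longrightarrow> b j = 0)" if "0 \<le> L" for L
  proof -
    obtain p where p: "p \<ge> L" "\<And>j. \<bar>j - p\<bar> \<le> L \<Longrightarrow> b j = 0" using window[of L] by blast
    obtain j where j: "p < j" "b j \<noteq> 0" using inf by blast
    define d where "d = (LEAST d. b (p + int d) \<noteq> 0)"
    have "b (p + int (nat (j - p))) \<noteq> 0" using j by simp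
    then have d: "b (p + int d) \<noteq> 0" unfolding d_def by (rule LeastI)
    have least: "b (p + int i) = 0" if "i < d" for i
      using not_less_Least[of i "\<lambda>d. b (p + int d) \<noteq> 0"] that unfolding d_def by blast
    have "int d > L" using p(2)[of "p + int d"] d \<open>0 \<le> L\<close> by (cases "int d \<le> L") auto
    moreover have "b i = 0" if "p + int d - L \<le> i" "i < p + int d" for i
    proof (cases "i < p")
      case True
      then show ?thesis using that \<open>0 \<le> L\<close> by (intro p(2)) linarith
    next
      case False
      then show ?thesis using least[of "nat (i - p)"] that by simp
    qed
    ultimately show ?thesis using d p(1) \<open>0 \<le> L\<close> by (intro exI[of _ "p + int d"]) auto
  qed
  have "\<exists>s. \<forall>k. (0 < s k \<and> b (s k) \<noteq> 0) \<and> (s k < s (Suc k) \<and>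
      (\<forall>j. s (Suc k) - s k \<le> j \<longrightarrow> j < s (Suc k) \<longrightarrow> b j = 0))"
  proof (rule dependent_nat_choice)
    show "\<exists>x. 0 < x \<and> b x \<noteq> 0" using gap[of 0] by auto
    show "\<exists>y. (0 < y \<and> b y \<noteq> 0) \<and> (x < y \<and> (\<forall>j. y - x \<le> j \<longrightarrow> j < y \<longrightarrow> b j = 0))"
      if "0 < x \<and> b x \<noteq> 0" for x
      using gap[of x] that by (meson less_imp_le less_trans)
  qed
  then obtain s where s: "\<And>k. 0 < s k" "\<And>k. b (s k) \<noteq> 0" "\<And>k. s k < s (Suc k)"
    "\<And>k j. s (Suc k) - s k \<le> j \<Longrightarrow> j < s (Suc k) \<Longrightarrow> b j = 0" by blast
  have diff_less: "b (s l - s i) = 0" if "i < l" for i l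
  proof -
    obtain l' where l: "l = Suc l'" "i \<le> l'" using \<open>i < l\<close> by (cases l) auto
    have "s i \<le> s l'"
      by (rule lift_Suc_mono_le[OF _ l(2)]) (rule less_imp_le[OF s(3)])
    then show ?thesis using s(1)[of i] l(1) by (intro s(4)[of l']) auto
  qed
  have diff: "b (s i - s l) = 0" if "i \<noteq> l" for i l
    using that diff_less[of i l] diff_less[of l i] even[of "s i - s l"]
    by (cases i l rule: linorder_cases) auto
  \<comment> \<open>The added 1 makes \<open>B\<close> positive even if \<open>b 0 = 0\<close>, so
    that one can divide by it.\<close>
  define B where "B = b 0 + 1"
  have b0: "0 \<le> b 0" using psd[where n = 1 and v = "\<lambda>_. 1" and u = "\<lambda>_. 0"] by simp
  then have B: "0 < B" "b 0 \<le> B" by (auto simp: B_def)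
  obtain N :: nat where N: "B\<^sup>2 / \<delta>\<^sup>2 < real N" using reals_Archimedean2 by blast
  \<comment> \<open>This minimises
    \<open>\<tau> ^ 2 * B - 2 * \<tau> * (N * \<delta>) + N * B\<close>, and \<open>N\<close> is
    large enough for the minimum to be negative.\<close>
  define \<tau> where "\<tau> = real N * \<delta> / B"
  \<comment> \<open>The quadratic form for the orthogonal \<open>s k\<close> and the point \<open>0\<close> that correlates with all of them.\<close>
  define v where "v i = (case i of 0 \<Rightarrow> \<tau> | Suc k \<Rightarrow> - sgn (b (s k)))" for i
  define u where "u i = (case i of 0 \<Rightarrow> 0 | Suc k \<Rightarrow> s k)" for i
  have "0 \<le> (\<Sum>i<Suc N. \<Sum>j<Suc N. v i * v j * b (u i - u j))" by (rule psd)
  also have "\<dots> = \<tau>\<^sup>2 * b 0 - 2 * \<tau> * (\<Sum>k<N. \<bar>b (s k)\<bar>) + real N * b 0"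
  proof -
    have d: "(\<Sum>j<N. sgn (b (s i)) * sgn (b (s j)) * b (s i - s j)) = b 0" if "i < N" for i
    proof -
      have "(\<Sum>j<N. sgn (b (s i)) * sgn (b (s j)) * b (s i - s j)) = (\<Sum>j<N. if j = i then b 0 else 0)"
        using s(2) diff by (intro sum.cong refl) (auto simp: sgn_if)
      then show ?thesis using that by simp
    qed
    have e: "\<tau> * sgn (b (s j)) * b (- s j) = \<tau> * \<bar>b (s j)\<bar>"
      "sgn (b (s j)) * \<tau> * b (s j) = \<tau> * \<bar>b (s j)\<bar>" for j
      by (simp_all only: even abs_sgn mult_ac)
    show ?thesis
      unfolding sum.lessThan_Suc_shift
      by (simp add: d e v_def u_def sum.distrib sum_negf sum_subtractf power2_eq_square
          flip: sum_distrib_left)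
  qed
  also have "\<dots> \<le> \<tau>\<^sup>2 * B - 2 * \<tau> * (real N * \<delta>) + real N * B"
  proof -
    have "real N * \<delta> \<le> (\<Sum>k<N. \<bar>b (s k)\<bar>)"
      using sum_bounded_below[of "{..<N}" \<delta> "\<lambda>k. \<bar>b (s k)\<bar>"] \<delta>(2) s(2) by simp
    then have "\<tau> * (real N * \<delta>) \<le> \<tau> * (\<Sum>k<N. \<bar>b (s k)\<bar>)"
      using B \<delta>(1) by (intro mult_left_mono) (auto simp: \<tau>_def)
    moreover have "\<tau>\<^sup>2 * b 0 \<le> \<tau>\<^sup>2 * B" "real N * b 0 \<le> real N * B"
      using B by (auto intro: mult_left_mono)
    ultimately show ?thesis by (simp add: mult.assoc)
  qed
  also have "\<dots> = real N * (B\<^sup>2 - real N * \<delta>\<^sup>2) / B"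
    using B by (simp add: \<tau>_def field_simps power2_eq_square)
  also have "\<dots> < 0"
  proof -
    have "B\<^sup>2 < real N * \<delta>\<^sup>2" using N \<delta>(1) by (simp add: divide_less_eq)
    moreover have "0 < real N" using N zero_le_divide_iff[of "B\<^sup>2" "\<delta>\<^sup>2"] by (meson le_less_trans zero_le_power2)
    ultimately show ?thesis using B by (simp add: divide_less_0_iff mult_less_0_iff)
  qed
  finally show False by simp
qed

section \<open>Eventually periodic coefficients\<close>

lemma cos_factors_shift: "cos_factors y k (\<lambda>l. c (l + i)) j = cos_factors y k c (j + i)"
  by (induction k arbitrary: j) (simp_all add: cos_factor_def algebra_simps)

text \<open>The hypothesis \<open>zero\<close> is a linear recurrence of order \<open>2 * K\<close>.
  Its states, lists of \<open>2 * K\<close> consecutive values, range over a finite set, so two of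
  them coincide, and the recurrence carries the coincidence on to all later values.\<close>

lemma eventually_periodic_if_cos_factors_zero:
  fixes c :: "int \<Rightarrow> real"
  assumes fin: "finite (range c)" and zero: "\<And>j. J < j \<Longrightarrow> cos_factors y K c j = 0"
  shows "\<exists>q>0. \<exists>J'. \<forall>j\<ge>J'. c (j + q) = c j"
proof -
  define J0 where "J0 = \<bar>J\<bar> + 1"
  define st where "st i = map (\<lambda>l. c (J0 + int i + int l)) [0..<2 * K]" for i
  have "range st \<subseteq> {xs. set xs \<subseteq> range c \<and> length xs = 2 * K}"
    by (auto simp: st_def)
  then have "finite (range st)"
    by (rule finite_subset) (rule finite_lists_length_eq[OF fin])
  then have "\<not> inj st" using finite_imageD[of st UNIV] infinite_UNIV_nat by blast
  then obtain i1 i2 where "st i1 = st i2" "i1 < i2"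
    unfolding inj_on_def by (metis linorder_neq_iff)
  then have start: "c (J0 + int i1 + int l) = c (J0 + int i2 + int l)" if "l < 2 * K" for l
    using that by (auto simp: st_def map_eq_conv)
  have all: "c (J0 + int i1 + int l) = c (J0 + int i2 + int l)" for l
  proof (induction l rule: less_induct)
    case (less l)
    show ?case
    proof (cases "l < 2 * K")
      case False
      define c1 where "c1 = (\<lambda>i. c (i + (J0 + int i1)))"
      define c2 where "c2 = (\<lambda>i. c (i + (J0 + int i2)))"
      \<comment> \<open>The centre of the window with topmost entry \<open>l\<close>; its other
        entries have smaller nonnegative indices because \<open>2 * K \<le> l\<close>.\<close>
      let ?j = "int l - int K"
      have "cos_factors y K c1 ?j - cos_factors y K c2 ?j = (c1 (?j + int K) - c2 (?j + int K)) / 2 ^ K"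
      proof (rule cos_factors_lead)
        fix i assume i: "\<bar>i - ?j\<bar> \<le> int K" "i \<noteq> ?j + int K"
        then have "nat i < l" "0 \<le> i" using False by linarith+
        then show "c1 i = c2 i" using less[of "nat i"] by (simp add: c1_def c2_def add_ac)
      qed
      moreover have "cos_factors y K c1 ?j = 0" "cos_factors y K c2 ?j = 0"
        using False unfolding c1_def c2_def cos_factors_shift J0_def by (auto intro!: zero)
      ultimately show ?thesis by (simp add: c1_def c2_def add_ac)
    qed (rule start)
  qed
  show ?thesis
  proof (rule exI[of _ "int i2 - int i1"], rule conjI, goal_cases)
    case 1
    show ?case using \<open>i1 < i2\<close> by simp
  next
    case 2
    have "c (j + (int i2 - int i1)) = c j" if "J0 + int i1 \<le> j" for j
      using all[of "nat (j - J0 - int i1)"] that by (simp add: algebra_simps)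
    then show ?case by blast
  qed
qed

text \<open>Fourier inversion at 0: the coefficients for all \<open>r\<close> add up to
  \<open>q * f 0\<close>, a nonzero real number, so they cannot all be purely imaginary.\<close>

lemma exists_fourier_coeff_Re_nonzero:
  fixes f :: "nat \<Rightarrow> real"
  assumes q: "0 < q" and f: "f 0 \<noteq> 0"
  shows "\<exists>r<q. Re (\<Sum>i<q. of_real (f i) * cis (real i * (2 * pi * real r / real q))) \<noteq> 0"
proof (rule ccontr)
  assume "\<not> ?thesis"
  then have "(\<Sum>r<q. Re (\<Sum>i<q. of_real (f i) * cis (real i * (2 * pi * real r / real q)))) = 0"
    by (intro sum.neutral) auto
  moreover have "(\<Sum>r<q. \<Sum>i<q. of_real (f i) * cis (real i * (2 * pi * real r / real q)))
      = of_real (real q * f 0)"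
  proof -
    have "(\<Sum>r<q. \<Sum>i<q. of_real (f i) * cis (real i * (2 * pi * real r / real q)))
        = (\<Sum>i<q. of_real (f i) * (\<Sum>r<q. cis (of_int (int i) * (2 * pi * real r / real q))))"
      by (subst sum.swap) (simp add: sum_distrib_left)
    also have "\<dots> = (\<Sum>i<q. if i = 0 then of_real (real q * f 0) else 0)"
    proof (rule sum.cong[OF refl])
      fix i assume "i \<in> {..<q}"
      then show "of_real (f i) * (\<Sum>r<q. cis (of_int (int i) * (2 * pi * real r / real q)))
          = (if i = 0 then of_real (real q * f 0) else 0)"
        by (subst sum_roots_of_unity) auto
    qed
    finally show ?thesis using q by simp
  qed
  then have "Re (\<Sum>r<q. \<Sum>i<q. of_real (f i) * cis (real i * (2 * pi * real r / real q))) = real q * f 0"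
    by simp
  ultimately show False using q f by (simp only: Re_sum) simp
qed

section \<open>Sums of periodic coefficients against powers of a number near 1\<close>

lemma periodic_block_sum:
  fixes d :: "nat \<Rightarrow> 'a :: comm_ring_1"
  assumes per: "\<And>j. J \<le> j \<Longrightarrow> d (j + q) = d j" and "J \<le> n"
  shows "(\<Sum>i<q. d (n + i)) = (\<Sum>i<q. d (J + i))"
  using assms(2)
proof (induction n rule: dec_induct)
  case (step n)
  have "(\<Sum>i<q. d (n + i)) - (\<Sum>i<q. d (Suc n + i)) = d (n + 0) - d (n + q)"
    unfolding sum_subtractf[symmetric] using sum_lessThan_telescope'[of "\<lambda>i. d (n + i)" q] by simp
  with per[of n] step show ?case by simp
qed simp

text \<open>Multiplication by \<open>1 - w ^ q\<close> cancels each term against the one a period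
  later, so only the first and the last block survive.\<close>

lemma periodic_twisted_sum:
  fixes d :: "nat \<Rightarrow> complex"
  assumes per: "\<And>j. J \<le> j \<Longrightarrow> d (j + q) = d j" and "J \<le> n"
  shows "(1 - w ^ q) * (\<Sum>j=J..<n. d j * w ^ j)
    = (\<Sum>i<q. d (J + i) * w ^ (J + i)) - (\<Sum>i<q. d (n + i) * w ^ (n + i))"
  using assms(2)
proof (induction n rule: dec_induct)
  case (step n)
  have "(\<Sum>i<q. d (n + i) * w ^ (n + i)) - (\<Sum>i<q. d (Suc n + i) * w ^ (Suc n + i))
      = d (n + 0) * w ^ (n + 0) - d (n + q) * w ^ (n + q)"
    unfolding sum_subtractf[symmetric]
    using sum_lessThan_telescope'[of "\<lambda>i. d (n + i) * w ^ (n + i)" q] by simp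
  also have "\<dots> = (1 - w ^ q) * (d n * w ^ n)"
    using per[OF step(1)] by (simp add: algebra_simps power_add)
  finally have "(1 - w ^ q) * (d n * w ^ n) = (\<Sum>i<q. d (n + i) * w ^ (n + i))
      - (\<Sum>i<q. d (Suc n + i) * w ^ (Suc n + i))" ..
  then show ?case
    using step by (simp only: sum.atLeastLessThan_Suc distrib_left) simp
qed simp

lemma cis_scaled_limit:
  assumes "0 < x"
  shows "(\<lambda>n. of_nat n * (1 - cis (x / real n))) \<longlonglongrightarrow> - \<i> * of_real x"
proof -
  have "(\<lambda>n. real n * (1 - cos (x / real n))) \<longlonglongrightarrow> 0" "(\<lambda>n. real n * - sin (x / real n)) \<longlonglongrightarrow> - x"
    using assms by real_asymp+
  from tendsto_Complex[OF this]
  have "(\<lambda>n. Complex (real n * (1 - cos (x / real n))) (real n * - sin (x / real n))) \<longlonglongrightarrow> Complex 0 (- x)" .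
  moreover have "Complex (real n * (1 - cos (x / real n))) (real n * - sin (x / real n))
      = of_nat n * (1 - cis (x / real n))" for n
    by (simp add: complex_eq_iff)
  moreover have "Complex 0 (- x) = - \<i> * of_real x"
    by (simp add: complex_eq_iff)
  ultimately show ?thesis by simp
qed

text \<open>The limit is the mean \<open>C / q\<close> of \<open>d\<close> over a period times the
  integral of \<open>cis (u * x)\<close> over [0, 1]. After telescoping, the first block tends to
  \<open>C\<close>, the last one to \<open>cis u * C\<close>, and the denominator
  \<open>n * (1 - w ^ q)\<close> to \<open>- \<i> * q * u\<close>.\<close>

lemma periodic_local_limit:
  fixes d :: "nat \<Rightarrow> complex"
  assumes per: "\<And>j. J \<le> j \<Longrightarrow> d (j + q) = d j" and q: "0 < q" and u: "0 < u"
    and bound: "\<And>j. norm (d j) \<le> A"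
  defines "C \<equiv> \<Sum>i<q. d (J + i)"
  shows "(\<lambda>n. (\<Sum>j\<le>n. d j * cis (u / real n) ^ j) / of_nat n)
    \<longlonglongrightarrow> C * (1 - cis u) / (- \<i> * of_real (real q * u))"
proof -
  let ?w = "\<lambda>n. cis (u / real n)"
  have w1: "?w \<longlonglongrightarrow> 1"
  proof -
    have "(\<lambda>n. u / real n) \<longlonglongrightarrow> 0" by real_asymp
    from tendsto_cis[OF this] show ?thesis by simp
  qed
  have head: "(\<lambda>n. \<Sum>i<q. d (J + i) * ?w n ^ (J + i)) \<longlonglongrightarrow> C"
  proof -
    have "(\<lambda>n. \<Sum>i<q. d (J + i) * ?w n ^ (J + i)) \<longlonglongrightarrow> (\<Sum>i<q. d (J + i) * 1 ^ (J + i))"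
      by (intro tendsto_intros w1)
    then show ?thesis by (simp add: C_def)
  qed
  have tail: "(\<lambda>n. \<Sum>i<q. d (Suc n + i) * ?w n ^ (Suc n + i)) \<longlonglongrightarrow> cis u * C"
  proof -
    have "(\<lambda>n. (\<Sum>i<q. d (Suc n + i) * ?w n ^ (Suc n + i)) - cis u * C) \<longlonglongrightarrow> 0"
    proof (rule Lim_null_comparison)
      show "\<forall>\<^sub>F n in sequentially. norm ((\<Sum>i<q. d (Suc n + i) * ?w n ^ (Suc n + i)) - cis u * C)
          \<le> (\<Sum>i<q. A * norm (?w n ^ Suc i - 1))"
        using eventually_ge_at_top[of "Suc J"]
      proof eventually_elim
        case (elim n)
        have "?w n ^ n = cis u" using elim by (simp add: Complex.DeMoivre)
        then have pow: "?w n ^ (Suc n + i) = cis u * ?w n ^ Suc i" for i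
          by (simp add: power_add)
        have "C = (\<Sum>i<q. d (Suc n + i))"
          unfolding C_def using periodic_block_sum[of J d q "Suc n"] per elim by simp
        then have "(\<Sum>i<q. d (Suc n + i) * ?w n ^ (Suc n + i)) - cis u * C
            = (\<Sum>i<q. cis u * (d (Suc n + i) * (?w n ^ Suc i - 1)))"
          by (simp only: pow sum_distrib_left sum_subtractf[symmetric])
            (intro sum.cong refl, simp add: algebra_simps)
        also have "norm \<dots> \<le> (\<Sum>i<q. A * norm (?w n ^ Suc i - 1))"
        proof (rule sum_norm_le)
          fix i
          show "norm (cis u * (d (Suc n + i) * (?w n ^ Suc i - 1))) \<le> A * norm (?w n ^ Suc i - 1)"
            using bound[of "Suc n + i"] by (simp only: norm_mult norm_cis mult_1 mult_right_mono norm_ge_zero)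
        qed
        finally show ?case .
      qed
      have "(\<lambda>n. \<Sum>i<q. A * norm (?w n ^ Suc i - 1)) \<longlonglongrightarrow> (\<Sum>i<q. A * norm (1 ^ Suc i - 1 :: complex))"
        by (intro tendsto_intros w1)
      then show "(\<lambda>n. \<Sum>i<q. A * norm (?w n ^ Suc i - 1)) \<longlonglongrightarrow> 0" by simp
    qed
    then show ?thesis by (rule LIM_zero_cancel)
  qed
  have denom: "(\<lambda>n. of_nat n * (1 - ?w n ^ q)) \<longlonglongrightarrow> - \<i> * of_real (real q * u)"
    using cis_scaled_limit[of "real q * u"] q u by (simp add: Complex.DeMoivre)
  have main: "(\<lambda>n. ((\<Sum>i<q. d (J + i) * ?w n ^ (J + i)) - (\<Sum>i<q. d (Suc n + i) * ?w n ^ (Suc n + i)))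
      / (of_nat n * (1 - ?w n ^ q))) \<longlonglongrightarrow> (C - cis u * C) / (- \<i> * of_real (real q * u))"
    using q u by (intro tendsto_divide tendsto_diff head tail denom) auto
  have start: "(\<lambda>n. (\<Sum>j<J. d j * ?w n ^ j) / of_nat n) \<longlonglongrightarrow> 0"
  proof -
    have "(\<lambda>n. (\<Sum>j<J. d j * ?w n ^ j) * (1 / of_nat n)) \<longlonglongrightarrow> (\<Sum>j<J. d j * 1 ^ j) * 0"
      by (intro tendsto_mult tendsto_sum tendsto_power w1 tendsto_const lim_1_over_n)
    then show ?thesis by simp
  qed
  have nz: "\<forall>\<^sub>F n in sequentially. of_nat n * (1 - ?w n ^ q) \<noteq> 0"
    by (intro tendsto_imp_eventually_ne[OF denom]) (use q u in simp)
  have "\<forall>\<^sub>F n in sequentially. (\<Sum>j<J. d j * ?w n ^ j) / of_nat n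
      + ((\<Sum>i<q. d (J + i) * ?w n ^ (J + i)) - (\<Sum>i<q. d (Suc n + i) * ?w n ^ (Suc n + i)))
      / (of_nat n * (1 - ?w n ^ q)) = (\<Sum>j\<le>n. d j * ?w n ^ j) / of_nat n"
    using nz eventually_ge_at_top[of J]
  proof eventually_elim
    case (elim n)
    have twisted: "(1 - ?w n ^ q) * (\<Sum>j=J..<Suc n. d j * ?w n ^ j)
        = (\<Sum>i<q. d (J + i) * ?w n ^ (J + i)) - (\<Sum>i<q. d (Suc n + i) * ?w n ^ (Suc n + i))"
      using elim(2) by (intro periodic_twisted_sum per) auto
    have split: "(\<Sum>j\<le>n. d j * ?w n ^ j) = (\<Sum>j<J. d j * ?w n ^ j) + (\<Sum>j=J..<Suc n. d j * ?w n ^ j)"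
      using elim(2) by (simp only: lessThan_Suc_atMost[symmetric] atLeast0LessThan[symmetric])
        (intro sum.atLeastLessThan_concat[symmetric], auto)
    have "x / m + (y * z) / (m * y) = (x + z) / m" if "m * y \<noteq> 0" for x y z m :: complex
      using that by (simp add: field_simps)
    from this[OF elim(1)] show ?case unfolding twisted[symmetric] split .
  qed
  then have "(\<lambda>n. (\<Sum>j\<le>n. d j * ?w n ^ j) / of_nat n) \<longlonglongrightarrow> 0 + (C - cis u * C) / (- \<i> * of_real (real q * u))"
    by (rule Lim_transform_eventually[OF tendsto_add[OF start main]])
  then show ?thesis by (simp add: algebra_simps)
qed

section \<open>From sign changes at scale 1/n to zeros\<close>

lemma NZ_ge_if_alternating:
  assumes alt: "\<And>k. k \<le> K \<Longrightarrow> 0 < (- 1) ^ k * cos_poly a n (t k)"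
    and incr: "\<And>k. k < K \<Longrightarrow> t k < t (Suc k)" and width: "t K < t 0 + 2 * pi"
  shows "enat K \<le> NZ c (cos_poly a n)"
proof -
  have cont: "continuous_on S (cos_poly a n)" for S
    unfolding cos_poly_def by (intro continuous_intros)
  have "\<exists>z>t k. z < t (Suc k) \<and> cos_poly a n z = 0" if k: "k < K" for k
  proof -
    let ?f = "\<lambda>x. (- 1) ^ k * cos_poly a n x"
    have s: "0 < ?f (t k)" "?f (t (Suc k)) < 0" using alt[of k] alt[of "Suc k"] k by auto
    have "\<exists>z\<ge>t k. z \<le> t (Suc k) \<and> ?f z = 0"
      using s incr[OF k] by (intro IVT2' continuous_intros cont) auto
    then obtain z where z: "t k \<le> z" "z \<le> t (Suc k)" "?f z = 0" by blast
    with s have "z \<noteq> t k" "z \<noteq> t (Suc k)" by auto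
    with z show ?thesis by (intro exI[of _ z]) auto
  qed
  then obtain z where z: "\<And>k. k < K \<Longrightarrow> t k < z k" "\<And>k. k < K \<Longrightarrow> z k < t (Suc k)"
    "\<And>k. k < K \<Longrightarrow> cos_poly a n (z k) = 0" by metis
  have t_mono: "t i \<le> t k" if "i \<le> k" "k \<le> K" for i k
    using that
  proof (induction k rule: dec_induct)
    case (step k)
    then show ?case using incr[of k] by auto
  qed simp
  have z_less: "z i < z k" if "i < k" "k < K" for i k
    using z(2)[of i] z(1)[of k] t_mono[of "Suc i" k] that by linarith
  have "inj_on z {..<K}"
  proof (rule inj_onI)
    fix i k assume "i \<in> {..<K}" "k \<in> {..<K}" "z i = z k"
    then show "i = k" using z_less[of i k] z_less[of k i] by (cases i k rule: linorder_cases) auto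
  qed
  then have "card (z ` {..<K}) = K" by (simp add: card_image)
  moreover have "enat (card (z ` {..<K})) \<le> NZ c (cos_poly a n)"
  proof (rule card_zeros_le_NZ)
    show "z ` {..<K} \<subseteq> {t 0..<t 0 + 2 * pi}"
    proof safe
      fix k assume "k < K"
      then show "z k \<in> {t 0..<t 0 + 2 * pi}"
        using z(1,2)[of k] t_mono[of 0 k] t_mono[of "Suc k" K] width by auto
    qed
  qed (auto simp: cos_poly_periodic z(3))
  ultimately show ?thesis by simp
qed

lemma NZ_ge_if_eventually_periodic:
  fixes a :: "nat \<Rightarrow> real"
  assumes fin: "finite (range a)" and ne: "\<forall>\<^sub>F j in sequentially. a j \<noteq> 0"
    and q: "0 < q" and per: "\<And>j. J \<le> j \<Longrightarrow> a (j + q) = a j"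
  shows "\<forall>\<^sub>F n in sequentially. enat K \<le> NZ c (cos_poly a n)"
proof -
  obtain J1 where J1: "\<And>j. J1 \<le> j \<Longrightarrow> a j \<noteq> 0" using ne by (auto simp: eventually_sequentially)
  \<comment> \<open>A multiple of \<open>q\<close>, so that starting the period here does not change
    the phases, and beyond both thresholds, so that \<open>a J0 \<noteq> 0\<close> and periodicity
    holds from here on.\<close>
  define J0 where "J0 = q * (J + J1)"
  have "J + J1 \<le> J0" using q by (simp add: J0_def)
  then have J0: "J \<le> J0" "a J0 \<noteq> 0" using J1[of J0] by auto
  obtain r where "Re (\<Sum>i<q. of_real (a (J0 + i)) * cis (real i * (2 * pi * real r / real q))) \<noteq> 0"
    using exists_fourier_coeff_Re_nonzero[OF q, of "\<lambda>i. a (J0 + i)"] J0(2) by auto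
  define \<theta> where "\<theta> = 2 * pi * real r / real q"
  define d where "d j = of_real (a j) * cis (real j * \<theta>)" for j
  have cis_add_period: "cis (real (j + q * m) * \<theta>) = cis (real j * \<theta>)" for j m
  proof -
    have "real (j + q * m) * \<theta> = real j * \<theta> + 2 * pi * of_int (int (r * m))"
      using q by (simp add: \<theta>_def field_simps)
    then show ?thesis
      by (simp only: cis_mult[symmetric] cis_multiple_2pi Ints_of_int mult_1_right)
  qed
  have d_per: "d (j + q) = d j" if "J0 \<le> j" for j
    using per[of j] that J0(1) cis_add_period[of j 1] by (simp add: d_def)
  define C where "C = (\<Sum>i<q. d (J0 + i))"
  have "C = (\<Sum>i<q. of_real (a (J0 + i)) * cis (real i * (2 * pi * real r / real q)))"
    unfolding C_def d_def using cis_add_period[of _ "J + J1"]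
    by (simp add: J0_def \<theta>_def[symmetric] add.commute)
  with \<open>Re _ \<noteq> 0\<close> have ReC: "Re C \<noteq> 0" by simp
  define \<rho> where "\<rho> = norm C"
  define \<psi> where "\<psi> = Arg C"
  have C: "Re C = \<rho> * cos \<psi>" "Im C = \<rho> * sin \<psi>"
    using rcis_cmod_Arg[of C] by (metis \<rho>_def \<psi>_def Re_rcis Im_rcis)+
  have \<rho>: "0 < \<rho>" using ReC by (auto simp: \<rho>_def)
  \<comment> \<open>Here the nonzero real part enters: once
    \<open>\<bar>sin \<psi>\<bar> < 1\<close>, the difference
    \<open>sin (x + \<psi>) - sin \<psi>\<close> has the sign of \<open>sin (x + \<psi>)\<close>
    whenever the latter is 1 or -1.\<close>
  have "cos \<psi> \<noteq> 0" using ReC C by auto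
  then have "(sin \<psi>)\<^sup>2 < 1\<^sup>2" using sin_squared_eq[of \<psi>] by (simp add: zero_less_power2)
  then have sin: "\<bar>sin \<psi>\<bar> < 1" using abs_le_square_iff[of 1 "sin \<psi>"] by fastforce
  obtain A where A: "\<And>j. \<bar>a j\<bar> \<le> A"
    using finite_imp_bounded[OF fin] by (auto simp: bounded_iff)
  \<comment> \<open>Here \<open>sin (u k + \<psi>) = (- 1) ^ k\<close>, and \<open>k + 2\<close> makes \<open>u k\<close> positive.\<close>
  define u where "u k = real (k + 2) * pi + pi / 2 - \<psi>" for k
  have \<psi>_le: "\<psi> \<le> pi" using Arg_le_pi \<psi>_def by simp
  have u_pos: "0 < u k" for k
  proof -
    have "2 * pi \<le> real (k + 2) * pi" by simp
    then show ?thesis using \<psi>_le pi_gt_zero unfolding u_def by linarith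
  qed
  have lim: "(\<lambda>n. cos_poly a n (\<theta> + x / real n) / real n)
      \<longlonglongrightarrow> \<rho> * (sin (x + \<psi>) - sin \<psi>) / (real q * x)" if x: "0 < x" for x
  proof -
    have "(\<lambda>n. Re ((\<Sum>j\<le>n. d j * cis (x / real n) ^ j) / of_nat n))
      \<longlonglongrightarrow> Re (C * (1 - cis x) / (- \<i> * of_real (real q * x)))"
      unfolding C_def by (intro tendsto_Re periodic_local_limit[where d = d and J = J0 and A = A] d_per q x)
        (simp_all add: d_def norm_mult A)
    moreover have "Re ((\<Sum>j\<le>n. d j * cis (x / real n) ^ j) / of_nat n)
        = cos_poly a n (\<theta> + x / real n) / real n" for n
    proof -
      have "Re (d j * cis (x / real n) ^ j) = a j * cos (real j * (\<theta> + x / real n))" for j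
      proof -
        have "d j * cis (x / real n) ^ j = of_real (a j) * cis (real j * (\<theta> + x / real n))"
          by (simp add: d_def Complex.DeMoivre cis_mult ring_distribs mult.assoc)
        then show ?thesis by simp
      qed
      then have "Re (\<Sum>j\<le>n. d j * cis (x / real n) ^ j) = cos_poly a n (\<theta> + x / real n)"
        by (simp add: cos_poly_def)
      then show ?thesis by simp
    qed
    moreover have "Re (C * (1 - cis x) / (- \<i> * of_real (real q * x)))
        = \<rho> * (sin (x + \<psi>) - sin \<psi>) / (real q * x)"
    proof -
      have "y / (- \<i> * z) = (\<i> * y) / z" for y z :: complex
        unfolding divide_inverse inverse_mult_distrib by (simp add: mult_ac)
      then have "C * (1 - cis x) / (- \<i> * of_real (real q * x)) = (\<i> * (C * (1 - cis x))) / of_real (real q * x)"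
        by simp
      also have "Re \<dots> = (Re C * sin x - Im C * (1 - cos x)) / (real q * x)"
        by (simp only: Re_divide_of_real) (simp add: algebra_simps)
      finally show ?thesis by (simp add: C sin_add algebra_simps)
    qed
    ultimately show ?thesis by (simp only:)
  qed
  have limit_sign: "0 < (- 1) ^ k * (\<rho> * (sin (u k + \<psi>) - sin \<psi>) / (real q * u k))" for k
  proof -
    have "sin (u k + \<psi>) = cos (real (k + 2) * pi)"
      by (simp add: u_def sin_add)
    also have "\<dots> = (- 1) ^ k" by (simp only: cos_npi) simp
    finally have "(- 1) ^ k * (sin (u k + \<psi>) - sin \<psi>) = 1 - (- 1) ^ k * sin \<psi>"
      by (simp add: right_diff_distrib flip: power_add mult_2)
    also have "\<dots> > 0" using sin by (cases "even k") auto
    finally have "0 < (- 1) ^ k * (sin (u k + \<psi>) - sin \<psi>)" .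
    then have "0 < ((- 1) ^ k * (sin (u k + \<psi>) - sin \<psi>)) * (\<rho> / (real q * u k))"
      using \<rho> q u_pos[of k] by (intro mult_pos_pos[OF _ divide_pos_pos]) auto
    then show ?thesis by (simp add: mult_ac)
  qed
  have ev: "\<forall>\<^sub>F n in sequentially. 0 < (- 1) ^ k * cos_poly a n (\<theta> + u k / real n)" for k
  proof -
    have "(\<lambda>n. (- 1) ^ k * (cos_poly a n (\<theta> + u k / real n) / real n))
        \<longlonglongrightarrow> (- 1) ^ k * (\<rho> * (sin (u k + \<psi>) - sin \<psi>) / (real q * u k))"
      by (intro tendsto_mult tendsto_const lim u_pos)
    then have "\<forall>\<^sub>F n in sequentially. 0 < (- 1) ^ k * (cos_poly a n (\<theta> + u k / real n) / real n)"
      by (rule order_tendstoD(1)[OF _ limit_sign])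
    then show ?thesis
      by eventually_elim (auto simp: zero_less_mult_iff zero_less_divide_iff divide_less_0_iff)
  qed
  have "\<forall>\<^sub>F n in sequentially. \<forall>k\<in>{..K}. 0 < (- 1) ^ k * cos_poly a n (\<theta> + u k / real n)"
    by (intro eventually_ball_finite ballI ev) simp
  \<comment> \<open>For such \<open>n\<close> all sample points fit into one period.\<close>
  moreover have "\<forall>\<^sub>F n in sequentially. (u K - u 0) / (2 * pi) < real n"
    using filterlim_real_sequentially by (simp add: filterlim_at_top_dense)
  ultimately show ?thesis
    using eventually_gt_at_top[of 0]
  proof eventually_elim
    case (elim n)
    show ?case
    proof (rule NZ_ge_if_alternating[where t = "\<lambda>k. \<theta> + u k / real n"])
      show "0 < (- 1) ^ k * cos_poly a n (\<theta> + u k / real n)" if "k \<le> K" for k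
        using elim(1) that by simp
      show "\<theta> + u k / real n < \<theta> + u (Suc k) / real n" for k
        using elim(3) by (simp add: u_def divide_strict_right_mono algebra_simps)
      show "\<theta> + u K / real n < \<theta> + u 0 / real n + 2 * pi"
      proof -
        have "(u K - u 0) / real n < 2 * pi"
          using elim(2,3) by (simp add: divide_less_eq mult.commute)
        then show ?thesis by (simp add: diff_divide_distrib)
      qed
    qed
  qed
qed

section \<open>The number of zeros tends to infinity\<close>

text \<open>The value at \<open>0\<close> is doubled so that the symmetric sum is \<open>2 T\<^sub>n\<close>.\<close>

definition even_extension :: "(nat \<Rightarrow> real) \<Rightarrow> int \<Rightarrow> real" where
  "even_extension a l = (if l = 0 then 2 * a 0 else a (nat \<bar>l\<bar>))"

lemma cos_sum_even_extension: "cos_sum N (even_extension a) t = 2 * cos_poly a N t"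
proof (induction N)
  case 0
  show ?case by (simp add: cos_sum_def cos_poly_def even_extension_def)
next
  case (Suc N)
  have "{- int (Suc N)..int (Suc N)} = insert (- int (Suc N)) (insert (int (Suc N)) {- int N..int N})"
    by auto
  then have "cos_sum (Suc N) (even_extension a) t
      = 2 * (a (Suc N) * cos (real (Suc N) * t)) + cos_sum N (even_extension a) t"
    using cos_minus[of "t + t * real N"] unfolding cos_sum_def
    by (simp add: even_extension_def nat_add_distrib algebra_simps)
  with Suc show ?case by (simp add: cos_poly_def)
qed

lemma NZ_frequently_small_imp_periodic:
  fixes a :: "nat \<Rightarrow> real"
  assumes fin: "finite (range a)" and small: "\<exists>\<^sub>F n in sequentially. NZ c (cos_poly a n) < enat K"
  shows "\<exists>q>0. \<exists>J. \<forall>j\<ge>J. a (j + q) = a j"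
proof -
  have "infinite {n. NZ c (cos_poly a n) < enat K}"
    using small unfolding cofinite_eq_sequentially[symmetric] frequently_cofinite .
  then obtain N0 :: "nat \<Rightarrow> nat" where N0: "strict_mono N0" "\<And>k. NZ c (cos_poly a (N0 k)) < enat K"
    using infinite_enumerate by blast
  have "\<forall>k. \<exists>y. (\<forall>i. \<bar>y i\<bar> \<le> 2) \<and> (\<forall>t. 0 \<le> (\<Prod>i<K. cos t - y i) * cos_poly a (N0 k) t)"
    using exists_cos_sign_factors[OF N0(2)] by blast
  then obtain y0 :: "nat \<Rightarrow> nat \<Rightarrow> real" where y0: "\<And>k i. \<bar>y0 k i\<bar> \<le> 2"
    "\<And>k t. 0 \<le> (\<Prod>i<K. cos t - y0 k i) * cos_poly a (N0 k) t"
    by metis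
  \<comment> \<open>Compactness: a diagonal subsequence makes every root converge.\<close>
  obtain r where r: "strict_mono r" "\<And>i. \<exists>l. (\<lambda>k. y0 (r k) i) \<longlonglongrightarrow> l"
    using function_convergent_subsequence[of "UNIV :: nat set" y0 2] y0(1) by auto
  define N where "N = N0 \<circ> r"
  define y where "y k = y0 (r k)" for k
  have N: "strict_mono N" unfolding N_def using N0(1) r(1) by (rule strict_mono_o)
  have y: "\<bar>y k i\<bar> \<le> 2" "0 \<le> (\<Prod>i<K. cos t - y k i) * cos_poly a (N k) t" for k i t
    using y0 by (auto simp: y_def N_def)
  obtain yl where yl: "\<And>i. (\<lambda>k. y k i) \<longlonglongrightarrow> yl i" using r(2) unfolding y_def by metis
  have yl_le: "\<bar>yl i\<bar> \<le> 2" for i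
    using tendsto_rabs[OF yl[of i]] y(1) by (intro LIMSEQ_le_const2) auto
  define \<alpha> where "\<alpha> = even_extension a"
  have "range \<alpha> \<subseteq> insert (2 * a 0) (range a)" by (auto simp: \<alpha>_def even_extension_def)
  then have fin\<alpha>: "finite (range \<alpha>)" using fin by (meson finite.insertI finite_subset)
  obtain A where A: "\<And>j. \<bar>\<alpha> j\<bar> \<le> A"
    using finite_imp_bounded[OF fin\<alpha>] by (auto simp: bounded_iff)
  have A0: "0 \<le> A" using A[of 0] by linarith
  \<comment> \<open>The truncation carries the coefficients of twice the cosine polynomial, so
    \<open>cc k\<close> belongs to a nonnegative function without frequencies above
    \<open>N k + K\<close>. Its formal counterpart \<open>b\<close> uses the whole series and the
    limiting roots.\<close>
  define tr where "tr k l = (if \<bar>l\<bar> \<le> int (N k) then \<alpha> l else 0)" for k l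
  define cc where "cc k = cos_factors (y k) K (tr k)" for k
  define b where "b = cos_factors yl K \<alpha>"
  have even\<alpha>: "\<alpha> (- j) = \<alpha> j" for j by (simp add: \<alpha>_def even_extension_def)
  have pd: "moment_seq (cc k)" for k
  proof (rule moment_seq_if_nonneg[where ?R0.0 = "N k + K"])
    show "cc k (- j) = cc k j" for j
      unfolding cc_def by (rule cos_factors_even) (simp add: tr_def even\<alpha>)
    show "cc k j = 0" if "\<bar>j\<bar> > int (N k + K)" for j
      unfolding cc_def using that by (intro cos_factors_support[where R = "int (N k)"]) (auto simp: tr_def)
    show "0 \<le> cos_sum (N k + K) (cc k) t" for t
    proof -
      have "cos_sum (N k) (tr k) t = cos_sum (N k) \<alpha> t"
        unfolding cos_sum_def by (intro sum.cong) (auto simp: tr_def)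
      then have "cos_sum (N k + K) (cc k) t = 2 * ((\<Prod>i<K. cos t - y k i) * cos_poly a (N k) t)"
        unfolding cc_def by (subst cos_sum_factors) (auto simp: tr_def \<alpha>_def cos_sum_even_extension)
      then show ?thesis using y(2)[of t k] by simp
    qed
  qed
  have close: "\<forall>\<^sub>F k in sequentially. \<forall>j. \<bar>j\<bar> \<le> int (N k) - int K \<longrightarrow> \<bar>cc k j - b j\<bar> \<le> e"
    if e: "0 < e" for e
  proof -
    define L where "L = real K * 3 ^ K * A"
    have L: "0 \<le> L" using A0 by (simp add: L_def)
    define \<delta> where "\<delta> = e / (L + 1)"
    have \<delta>: "0 < \<delta>" using e L by (simp add: \<delta>_def)
    have "\<forall>\<^sub>F k in sequentially. \<forall>i\<in>{..<K}. \<bar>y k i - yl i\<bar> \<le> \<delta>"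
    proof (intro eventually_ball_finite ballI)
      show "\<forall>\<^sub>F k in sequentially. \<bar>y k i - yl i\<bar> \<le> \<delta>" for i
        using tendstoD[OF yl[of i] \<delta>] by eventually_elim (auto simp: dist_real_def less_imp_le)
    qed simp
    then show ?thesis
    proof eventually_elim
      case (elim k)
      show ?case
      proof (intro allI impI)
        fix j assume "\<bar>j\<bar> \<le> int (N k) - int K"
        then have "cc k j = cos_factors (y k) K \<alpha> j"
          unfolding cc_def by (intro cos_factors_local) (auto simp: tr_def)
        then have "\<bar>cc k j - b j\<bar> \<le> real K * 3 ^ K * A * \<delta>"
          unfolding b_def using elim y(1) yl_le A by (auto intro: cos_factors_lipschitz)
        also have "\<dots> = e * (L / (L + 1))" by (simp add: L_def \<delta>_def)
        also have "\<dots> \<le> e * 1" using e L by (intro mult_left_mono) auto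
        finally show "\<bar>cc k j - b j\<bar> \<le> e" by simp
      qed
    qed
  qed
  have finb: "finite (range b)" unfolding b_def using fin\<alpha> by (rule cos_factors_finite_range)
  have b_le: "\<bar>b j\<bar> \<le> 3 ^ K * A" for j
    unfolding b_def using yl_le A by (intro cos_factors_bound) auto
  have N_top: "filterlim (\<lambda>k. int (N k)) at_top sequentially"
    by (rule filterlim_compose[OF filterlim_int_sequentially filterlim_subseq[OF N]])
  have "\<exists>s :: nat \<Rightarrow> nat. strict_mono s \<and> (\<forall>x. (\<lambda>k. b (int (N (s k)) + x)) \<longlonglongrightarrow> 0)"
  proof (rule moment_seq_window[where c = cc and K = "int K" and B = "3 ^ K * A"])
    show "cc k j = 0" if "int (N k) + int K < j" for k j
      unfolding cc_def using that by (intro cos_factors_support[where R = "int (N k)"]) (auto simp: tr_def)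
  qed (use pd N_top close b_le in auto)
  then obtain s where s: "strict_mono s" "\<And>x. (\<lambda>k. b (int (N (s k)) + x)) \<longlonglongrightarrow> 0"
    by blast
  \<comment> \<open>As \<open>b\<close> has finitely many values, the nonzero ones stay away from 0,
    and convergence to 0 on a window becomes exact vanishing.\<close>
  obtain \<delta> where \<delta>: "0 < \<delta>" "\<And>j. b j \<noteq> 0 \<Longrightarrow> \<delta> \<le> \<bar>b j\<bar>"
    using finite_set_avoid[OF finb, of 0] by (auto simp: dist_real_def)
  have "\<exists>J. \<forall>j>J. b j = 0"
  proof (rule psd_gap[OF _ _ \<delta>])
    show "b (- j) = b j" for j unfolding b_def by (rule cos_factors_even) (rule even\<alpha>)
    \<comment> \<open>Each quadratic form involves finitely many values, so pointwise convergence
      transfers positive definiteness to \<open>b\<close>.\<close>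
    have lim: "(\<lambda>k. cc k j) \<longlonglongrightarrow> b j" for j
    proof (rule tendstoI)
      fix e :: real assume "0 < e"
      then have "\<forall>\<^sub>F k in sequentially. \<forall>j. \<bar>j\<bar> \<le> int (N k) - int K \<longrightarrow> \<bar>cc k j - b j\<bar> \<le> e / 2"
        by (intro close) simp
      moreover have "\<forall>\<^sub>F k in sequentially. \<bar>j\<bar> + int K \<le> int (N k)"
        using N_top unfolding filterlim_at_top by blast
      ultimately show "\<forall>\<^sub>F k in sequentially. dist (cc k j) (b j) < e"
      proof eventually_elim
        case (elim k)
        then have "\<bar>cc k j - b j\<bar> \<le> e / 2" by (simp add: le_diff_eq)
        then show ?case using \<open>0 < e\<close> by (simp add: dist_real_def)
      qed
    qed
    show "0 \<le> (\<Sum>i<n. \<Sum>j<n. v i * v j * b (u i - u j))" for n :: nat and v u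
    proof (rule LIMSEQ_le_const)
      show "(\<lambda>k. \<Sum>i<n. \<Sum>j<n. v i * v j * cc k (u i - u j)) \<longlonglongrightarrow> (\<Sum>i<n. \<Sum>j<n. v i * v j * b (u i - u j))"
        by (intro tendsto_intros lim)
      show "\<exists>k0. \<forall>k\<ge>k0. 0 \<le> (\<Sum>i<n. \<Sum>j<n. v i * v j * cc k (u i - u j))"
        using moment_seq_psd[OF pd] by blast
    qed
    show "\<exists>p\<ge>L. \<forall>j. \<bar>j - p\<bar> \<le> L \<longrightarrow> b j = 0" for L
    proof -
      have "\<forall>\<^sub>F k in sequentially. \<forall>x\<in>{- L..L}. b (int (N (s k)) + x) = 0"
      proof (intro eventually_ball_finite ballI)
        fix x
        have "\<forall>\<^sub>F k in sequentially. \<bar>b (int (N (s k)) + x)\<bar> < \<delta>"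
          using tendstoD[OF s(2)[of x] \<delta>(1)] by simp
        then show "\<forall>\<^sub>F k in sequentially. b (int (N (s k)) + x) = 0"
          by eventually_elim (use \<delta>(2) in force)
      qed simp
      moreover have "\<forall>\<^sub>F k in sequentially. L \<le> int (N (s k))"
        using filterlim_compose[OF N_top filterlim_subseq[OF s(1)]] unfolding filterlim_at_top by blast
      ultimately have "\<forall>\<^sub>F k in sequentially. (\<forall>x\<in>{- L..L}. b (int (N (s k)) + x) = 0) \<and> L \<le> int (N (s k))"
        by (rule eventually_conj)
      then obtain k where k: "\<And>x. x \<in> {- L..L} \<Longrightarrow> b (int (N (s k)) + x) = 0" "L \<le> int (N (s k))"
        using eventually_happens'[OF sequentially_bot] by blast
      have "b j = 0" if "\<bar>j - int (N (s k))\<bar> \<le> L" for j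
        using k(1)[of "j - int (N (s k))"] that by (simp add: abs_le_iff)
      with k(2) show ?thesis by blast
    qed
  qed
  then obtain J where "\<And>j. J < j \<Longrightarrow> cos_factors yl K \<alpha> j = 0" unfolding b_def by blast
  then obtain q J' where q: "0 < q" "\<And>j. J' \<le> j \<Longrightarrow> \<alpha> (j + q) = \<alpha> j"
    using eventually_periodic_if_cos_factors_zero[OF fin\<alpha>] by metis
  show ?thesis
  proof (intro exI conjI)
    show "0 < nat q" using q(1) by simp
    \<comment> \<open>The \<open>+ 1\<close> avoids the index 0, where \<open>even_extension\<close>
      doubles the value.\<close>
    show "\<forall>j\<ge>nat \<bar>J'\<bar> + 1. a (j + nat q) = a j"
    proof (intro allI impI)
      fix j assume "nat \<bar>J'\<bar> + 1 \<le> j"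
      then have "J' \<le> int j" "0 < j" by linarith+
      then show "a (j + nat q) = a j"
        using q(1) q(2)[of "int j"] by (simp add: \<alpha>_def even_extension_def nat_add_distrib)
    qed
  qed
qed

theorem theorem1p2:
  fixes a :: "nat \<Rightarrow> real" and c :: real
  assumes "finite (range a)"
    and "\<forall>\<^sub>F j in sequentially. a j \<noteq> 0"
  shows "(\<lambda>n. NZ c (cos_poly a n)) \<longlonglongrightarrow> \<infinity>"
proof (rule order_tendstoI)
  fix x :: enat assume "x < \<infinity>"
  then obtain m where m: "x = enat m" by auto
  have "\<forall>\<^sub>F n in sequentially. enat (Suc m) \<le> NZ c (cos_poly a n)"
  proof (rule ccontr)
    assume not: "\<not> ?thesis"
    then have "\<exists>\<^sub>F n in sequentially. NZ c (cos_poly a n) < enat (Suc m)"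
      by (simp add: frequently_def not_less)
    \<comment> \<open>Infinitely many small counts force eventual periodicity, but eventually
      periodic coefficients make the counts exceed every bound.\<close>
    then obtain q J where "0 < q" "\<And>j. J \<le> j \<Longrightarrow> a (j + q) = a j"
      using NZ_frequently_small_imp_periodic[OF assms(1)] by blast
    then show False
      using NZ_ge_if_eventually_periodic[OF assms] not by blast
  qed
  then show "\<forall>\<^sub>F n in sequentially. x < NZ c (cos_poly a n)"
    by eventually_elim (auto simp: m Suc_ile_eq)
qed simp

end
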